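(* Fix $\beta=1$ and let $M\in\mathbb N$ be fixed. Assume $k=k(N)\to\infty$ satisfies $$\frac{k(N)}{N^{1/2}}\longrightarrow 0 .$$ Let $\mu_N^{(k)}$ be the marginal on $(\sigma_1,\dots,\sigma_k)$ of the Hopfield Gibbs measure $\mu_N$ at inverse temperature $\beta=1$ with $N$ spins and $M$ patterns, and let $\pi$ be the Rademacher law on $\{-1,+1\}$. Then $$d_{\mathrm{TV}}\big(\mu_N^{(k)},\pi^{\otimes k}\big)\longrightarrow 0\qquad\text{in }\mathbb P_\xi\text{-probability}.$$
   Context: Hopfield model: let $\xi_i=(\xi_i^1,\dots,\xi_i^M)\in\{-1,+1\}^M$, $i=1,\dots,N$, be i.i.d. random vectors with independent coordinates, $\mathbb E[\xi_i^\nu]=0$ and $\mathbb E[(\xi_i^\nu)^2]=1$; $\mathbb P_\xi$ denotes their law (the disorder). For $\sigma\in\{-1,+1\}^N$ put $m_N(\sigma)=\frac1N\sum_{i=1}^N\sigma_i\xi_i\in\mathbb R^M$. For fixed $\xi$ and $\beta>0$ the Gibbs measure on $\{-1,+1\}^N$ is $\mu_N(\sigma)=\frac1{Z_N}\exp\big(\frac{\beta N}{2}\|m_N(\sigma)\|^2\big)$, where $\|\cdot\|$ is the Euclidean norm and $Z_N$ the normalizing constant; it is a random measure, depending on $\xi$. $\pi(\pm1)=\frac12$. $d_{\mathrm{TV}}(\nu,\varrho)=\sup_A|\nu(A)-\varrho(A)|$. *)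

theory Defs
  imports "HOL-Probability.Probability"
begin

text \<open>A spin configuration of \<open>N\<close> spins is an extensional function on \<open>{1..N}\<close>, and the number of
  patterns is \<open>M = CARD('m)\<close>. The norm of \<^typ>\<open>real ^ 'm\<close> is the Euclidean one.\<close>

definition spin_configs :: "nat \<Rightarrow> (nat \<Rightarrow> real) set" where
  "spin_configs N = {1..N} \<rightarrow>\<^sub>E {-1, 1}"

definition overlap :: "nat \<Rightarrow> (nat \<Rightarrow> real ^ 'm) \<Rightarrow> (nat \<Rightarrow> real) \<Rightarrow> real ^ 'm" where
  "overlap N x \<sigma> = (1 / real N) *\<^sub>R (\<Sum>i\<in>{1..N}. \<sigma> i *\<^sub>R x i)"

definition boltzmann_weight :: "real \<Rightarrow> nat \<Rightarrow> (nat \<Rightarrow> real ^ 'm) \<Rightarrow> (nat \<Rightarrow> real) \<Rightarrow> real" where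
  "boltzmann_weight \<beta> N x \<sigma> = exp (\<beta> * real N / 2 * (norm (overlap N x \<sigma>))\<^sup>2)"

definition partition_function :: "real \<Rightarrow> nat \<Rightarrow> (nat \<Rightarrow> real ^ 'm) \<Rightarrow> real" where
  "partition_function \<beta> N x = (\<Sum>\<sigma>\<in>spin_configs N. boltzmann_weight \<beta> N x \<sigma>)"

text \<open>The Gibbs measure for a fixed realization \<open>x\<close> of the patterns; only \<open>x 1, \<dots>, x N\<close> matter.\<close>

definition gibbs :: "real \<Rightarrow> nat \<Rightarrow> (nat \<Rightarrow> real ^ 'm) \<Rightarrow> (nat \<Rightarrow> real) pmf" where
  "gibbs \<beta> N x = embed_pmf (\<lambda>\<sigma>. if \<sigma> \<in> spin_configs N
     then boltzmann_weight \<beta> N x \<sigma> / partition_function \<beta> N x else 0)"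

lemma finite_spin_configs: "finite (spin_configs N)"
  by (simp add: spin_configs_def finite_PiE)

lemma spin_configs_nonempty: "spin_configs N \<noteq> {}"
  by (simp add: spin_configs_def PiE_eq_empty_iff)

lemma partition_function_pos: "partition_function \<beta> N x > 0"
  unfolding partition_function_def boltzmann_weight_def
  by (rule sum_pos) (auto simp: finite_spin_configs spin_configs_nonempty)

text \<open>The weights are normalized, so \<^const>\<open>embed_pmf\<close> is well-defined here.\<close>

lemma pmf_gibbs:
  "pmf (gibbs \<beta> N x) \<sigma> = (if \<sigma> \<in> spin_configs N
     then boltzmann_weight \<beta> N x \<sigma> / partition_function \<beta> N x else 0)"
proof -
  let ?f = "\<lambda>\<sigma>. if \<sigma> \<in> spin_configs N
     then boltzmann_weight \<beta> N x \<sigma> / partition_function \<beta> N x else 0"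
  have nn: "0 \<le> ?f \<sigma>" for \<sigma>
    using partition_function_pos[of \<beta> N x] by (simp add: boltzmann_weight_def)
  have "(\<integral>\<^sup>+\<sigma>. ennreal (?f \<sigma>) \<partial>count_space UNIV) = (\<Sum>\<sigma>\<in>spin_configs N. ennreal (?f \<sigma>))"
    by (rule nn_integral_count_space'[OF finite_spin_configs]) auto
  also have "\<dots> = ennreal (\<Sum>\<sigma>\<in>spin_configs N. ?f \<sigma>)"
    using nn by (intro sum_ennreal) blast
  also have "(\<Sum>\<sigma>\<in>spin_configs N. ?f \<sigma>) = 1"
    using partition_function_pos[of \<beta> N x]
    by (simp add: partition_function_def flip: sum_divide_distrib)
  finally show ?thesis
    unfolding gibbs_def using nn by (subst pmf_embed_pmf) auto
qed

definition spin_marginal :: "nat \<Rightarrow> (nat \<Rightarrow> real) pmf \<Rightarrow> (nat \<Rightarrow> real) pmf" where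
  "spin_marginal k \<mu> = map_pmf (\<lambda>\<sigma>. restrict \<sigma> {1..k}) \<mu>"

definition rademacher :: "real pmf" where
  "rademacher = pmf_of_set {-1, 1}"

text \<open>The default value \<^const>\<open>undefined\<close> is the one used by \<^const>\<open>restrict\<close>, so this lives on
  the same configurations as \<^term>\<open>spin_marginal k \<mu>\<close>.\<close>

definition rademacher_product :: "nat \<Rightarrow> (nat \<Rightarrow> real) pmf" where
  "rademacher_product k = Pi_pmf {1..k} undefined (\<lambda>_. rademacher)"

definition tv_dist :: "'a pmf \<Rightarrow> 'a pmf \<Rightarrow> real" where
  "tv_dist p q = (SUP A. \<bar>measure_pmf.prob p A - measure_pmf.prob q A\<bar>)"

locale hopfield_disorder = prob_space P
  for P :: "'p measure" +
  fixes N :: nat and \<xi> :: "nat \<Rightarrow> 'p \<Rightarrow> real ^ 'm"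
  assumes patterns_indep: "indep_vars (\<lambda>_. borel) \<xi> {1..N}"
    and patterns_ident: "i \<in> {1..N} \<Longrightarrow> j \<in> {1..N} \<Longrightarrow> distr P borel (\<xi> i) = distr P borel (\<xi> j)"
    and coords_indep: "i \<in> {1..N} \<Longrightarrow> indep_vars (\<lambda>_. borel) (\<lambda>\<nu> \<omega>. \<xi> i \<omega> $ \<nu>) UNIV"
    and coords_values: "i \<in> {1..N} \<Longrightarrow> \<omega> \<in> space P \<Longrightarrow> \<xi> i \<omega> $ \<nu> \<in> {-1, 1}"
    and coords_mean: "i \<in> {1..N} \<Longrightarrow> expectation (\<lambda>\<omega>. \<xi> i \<omega> $ \<nu>) = 0"
    and coords_second_moment: "i \<in> {1..N} \<Longrightarrow> expectation (\<lambda>\<omega>. (\<xi> i \<omega> $ \<nu>)\<^sup>2) = 1"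

text \<open>The \<open>n\<close>-th variable may live on its own probability space \<^term>\<open>P n\<close>. Measurability is
  required because \<^const>\<open>measure\<close> is \<open>0\<close> on non-measurable sets.\<close>

definition tendsto_in_probability ::
  "(nat \<Rightarrow> 'p measure) \<Rightarrow> (nat \<Rightarrow> 'p \<Rightarrow> real) \<Rightarrow> real \<Rightarrow> bool" where
  "tendsto_in_probability P X l \<longleftrightarrow>
     (\<forall>n. X n \<in> borel_measurable (P n)) \<and>
     (\<forall>\<epsilon>>0. (\<lambda>n. measure (P n) {\<omega> \<in> space (P n). \<bar>X n \<omega> - l\<bar> > \<epsilon>}) \<longlonglongrightarrow> 0)"

end

(* Let T be the contribution of the first k spins to N m and S that of the others. Flipping S
   and cosh >= 1 bound the marginal density with respect to the uniform law pointwise from below by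
   E_pi[exp(|S|^2/2N)] / E_pi[exp(|S+T|^2/2N)], which is at least 1 - E_mu<m,T> because
   exp(y) >= 1 + y. Hence the total variation distance is at most
   E_mu<m,T> = O(k (1/N + E_mu|m|^2)), and it remains to see that E_mu|m|^2 = O(N^(-1/2)).
   At beta = 1 a spin has conditional mean tanh(h_i) in its local field h_i, so that
   N E_mu|m|^2 = M + sum_i E_mu[h_i tanh h_i] with h tanh h <= h^2 - c h^4. Up to an error governed
   by the off-diagonal empirical correlations of the patterns (of order N^(-1/2) on average),
   sum_i h_i^2 equals N |m|^2; the quadratic terms cancel, and what is left bounds E_mu|m|^4 by a
   multiple of 1/N + N^(-1/2) E_mu|m|^2. *)

theory Submission
  imports Defs "HOL-Real_Asymp.Real_Asymp"
begin

section \<open>Elementary estimates for the hyperbolic tangent\<close>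

lemma tanh_ge_div:
  fixes x :: real
  assumes "0 \<le> x"
  shows "x / (1 + x) \<le> tanh x"
proof -
  have e: "1 + 2 * x \<le> exp (2 * x)"
    by (rule exp_ge_add_one_self)
  have pos: "0 < 1 + x" "0 < exp (2 * x) + 1"
    using assms by (auto intro: add_pos_pos)
  have "tanh x = (exp (2 * x) - 1) / (exp (2 * x) + 1)"
    by (simp add: tanh_real_altdef exp_minus divide_simps add_pos_pos)
  \<comment> \<open>With denominators cleared, the claim reduces to exp(2x) \<ge> 1 + 2x.\<close>
  moreover have "x * (exp (2 * x) + 1) \<le> (exp (2 * x) - 1) * (1 + x)"
    using e by (simp add: algebra_simps)
  ultimately show ?thesis
    using pos by (simp add: pos_divide_le_eq pos_le_divide_eq)
qed

text \<open>The derivative of t - tanh t is tanh(t)^2, which on [0, x] is at least (t / (1 + L))^2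
  by \<open>tanh_ge_div\<close>; integrating this gives the cubic gain.\<close>

lemma tanh_le_cubic:
  fixes x L :: real
  assumes "0 \<le> x" "x \<le> L"
  shows "tanh x \<le> x - x ^ 3 / (3 * (1 + L)\<^sup>2)"
proof -
  define c where "c = 1 / (1 + L)\<^sup>2"
  define f where "f = (\<lambda>t::real. t - c / 3 * t ^ 3 - tanh t)"
  have "f 0 \<le> f x"
  proof (rule DERIV_nonneg_imp_nondecreasing[OF assms(1)])
    fix t :: real assume t: "0 \<le> t" "t \<le> x"
    have "t / (1 + L) \<le> t / (1 + t)"
      using t assms by (intro divide_left_mono) auto
    also have "\<dots> \<le> tanh t"
      by (rule tanh_ge_div[OF t(1)])
    finally have "(t / (1 + L))\<^sup>2 \<le> (tanh t)\<^sup>2"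
      using t assms by (intro power_mono) auto
    hence "0 \<le> (tanh t)\<^sup>2 - c * t\<^sup>2"
      by (simp add: c_def power_divide)
    moreover have "(f has_real_derivative (tanh t)\<^sup>2 - c * t\<^sup>2) (at t)"
      unfolding f_def by (auto intro!: derivative_eq_intros simp: cosh_real_nonzero)
    ultimately show "\<exists>y. (f has_real_derivative y) (at t) \<and> 0 \<le> y"
      by blast
  qed
  thus ?thesis
    by (simp add: f_def c_def)
qed

text \<open>Follows from \<open>tanh_le_cubic\<close> at |x|, both sides being even. The quartic
  gain is what keeps the overlap small at \<beta> = 1, where the quadratic terms cancel.\<close>

lemma mult_tanh_le_quartic:
  fixes x L :: real
  assumes "\<bar>x\<bar> \<le> L"
  shows "x * tanh x \<le> x\<^sup>2 - x ^ 4 / (3 * (1 + L)\<^sup>2)"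
proof -
  have "x * tanh x = \<bar>x\<bar> * tanh \<bar>x\<bar>"
    by (cases "0 \<le> x") auto
  also have "\<dots> \<le> \<bar>x\<bar> * (\<bar>x\<bar> - \<bar>x\<bar> ^ 3 / (3 * (1 + L)\<^sup>2))"
    using assms by (intro mult_left_mono tanh_le_cubic) auto
  also have "\<dots> = \<bar>x\<bar>\<^sup>2 - \<bar>x\<bar> ^ 4 / (3 * (1 + L)\<^sup>2)"
    by (simp add: algebra_simps power2_eq_square eval_nat_numeral)
  finally show ?thesis
    by simp
qed

text \<open>The left side is the weight of a spin s in the field h times the deviation of s from its
  mean tanh h. Being odd in s, it sums to zero over the two spin values.\<close>

lemma exp_mult_sign_diff_tanh:
  fixes s h :: real
  assumes "s \<in> {-1, 1}"
  shows "exp (s * h) * (s - tanh h) = s / cosh h"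
proof -
  have "s * cosh h - sinh h = s * exp (- (s * h))"
    using assms cosh_plus_sinh[of h] cosh_minus_sinh[of h] by auto
  hence "s - tanh h = s * exp (- (s * h)) / cosh h"
    by (simp add: tanh_def field_simps cosh_real_nonzero)
  thus ?thesis
    by (simp add: exp_minus)
qed

section \<open>Gibbs averages and empirical pattern correlations\<close>

text \<open>A finite weighted sum instead of an integral against \<open>gibbs\<close>, so that
  linearity and monotonicity need no integrability.\<close>

definition gibbs_avg :: "nat \<Rightarrow> (nat \<Rightarrow> real ^ 'm) \<Rightarrow> ((nat \<Rightarrow> real) \<Rightarrow> real) \<Rightarrow> real" where
  "gibbs_avg N x f =
     (\<Sum>\<sigma>\<in>spin_configs N. boltzmann_weight 1 N x \<sigma> * f \<sigma>) / partition_function 1 N x"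

lemma gibbs_avg_add: "gibbs_avg N x (\<lambda>\<sigma>. f \<sigma> + g \<sigma>) = gibbs_avg N x f + gibbs_avg N x g"
  by (simp add: gibbs_avg_def distrib_left sum.distrib add_divide_distrib)

lemma gibbs_avg_cmult: "gibbs_avg N x (\<lambda>\<sigma>. c * f \<sigma>) = c * gibbs_avg N x f"
  by (simp add: gibbs_avg_def sum_distrib_left mult.left_commute)

lemma gibbs_avg_const: "gibbs_avg N x (\<lambda>\<sigma>. c) = c"
  using partition_function_pos[of 1 N x]
  by (simp add: gibbs_avg_def partition_function_def flip: sum_distrib_right)

lemma gibbs_avg_sum: "gibbs_avg N x (\<lambda>\<sigma>. \<Sum>i\<in>I. f i \<sigma>) = (\<Sum>i\<in>I. gibbs_avg N x (f i))"
  by (simp add: gibbs_avg_def sum_distrib_left sum.swap[of _ I] sum_divide_distrib)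

lemma gibbs_avg_mono:
  assumes "\<And>\<sigma>. \<sigma> \<in> spin_configs N \<Longrightarrow> f \<sigma> \<le> g \<sigma>"
  shows "gibbs_avg N x f \<le> gibbs_avg N x g"
  using partition_function_pos[of 1 N x] assms
  by (auto simp: gibbs_avg_def boltzmann_weight_def intro!: divide_right_mono sum_mono mult_left_mono)

lemma gibbs_avg_cong:
  assumes "\<And>\<sigma>. \<sigma> \<in> spin_configs N \<Longrightarrow> f \<sigma> = g \<sigma>"
  shows "gibbs_avg N x f = gibbs_avg N x g"
  using assms by (auto simp: gibbs_avg_def intro!: sum.cong)

text \<open>Nonnegativity of the variance: with a the average of f, the pointwise inequality 2 a f -
  a^2 \<le> f^2 is averaged.\<close>

lemma gibbs_avg_square_le: "(gibbs_avg N x f)\<^sup>2 \<le> gibbs_avg N x (\<lambda>\<sigma>. (f \<sigma>)\<^sup>2)"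
proof -
  define a where "a = gibbs_avg N x f"
  have "gibbs_avg N x (\<lambda>\<sigma>. (2 * a) * f \<sigma> + - a\<^sup>2) \<le> gibbs_avg N x (\<lambda>\<sigma>. (f \<sigma>)\<^sup>2)"
  proof (rule gibbs_avg_mono)
    fix \<sigma>
    show "(2 * a) * f \<sigma> + - a\<^sup>2 \<le> (f \<sigma>)\<^sup>2"
      using zero_le_power2[of "f \<sigma> - a"] by (simp add: power2_diff mult_ac)
  qed
  thus ?thesis
    unfolding gibbs_avg_add gibbs_avg_const gibbs_avg_cmult a_def[symmetric]
    by (simp add: power2_eq_square)
qed

lemma spin_value: "\<sigma> \<in> spin_configs N \<Longrightarrow> i \<in> {1..N} \<Longrightarrow> \<sigma> i \<in> {-1, 1}"
  by (auto simp: spin_configs_def)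

lemma spin_square: "\<sigma> \<in> spin_configs N \<Longrightarrow> i \<in> {1..N} \<Longrightarrow> \<sigma> i * \<sigma> i = 1"
  by (drule (1) spin_value) auto

text \<open>Entrywise size of the off-diagonal part of the sum of the matrices x_i x_i^T, without
  normalization. Under the disorder it is on average of order sqrt N, against N for each diagonal
  entry.\<close>

definition pattern_correlation :: "nat \<Rightarrow> (nat \<Rightarrow> real ^ 'm) \<Rightarrow> real" where
  "pattern_correlation N x = (\<Sum>\<nu>\<in>UNIV. \<Sum>\<mu>\<in>UNIV - {\<nu>}. \<bar>\<Sum>i\<in>{1..N}. x i $ \<nu> * x i $ \<mu>\<bar>)"

lemma pattern_correlation_nonneg: "0 \<le> pattern_correlation N x"
  by (simp add: pattern_correlation_def sum_nonneg)

section \<open>Restriction to the first k spins and total variation distance\<close>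

lemma overlap_eq_split:
  assumes "k \<le> N"
  shows "overlap N x \<sigma> = (1 / N) *\<^sub>R ((\<Sum>i\<in>{1..k}. \<sigma> i *\<^sub>R x i) + (\<Sum>i\<in>{k+1..N}. \<sigma> i *\<^sub>R x i))"
proof -
  have "{1..N} = {1..k} \<union> {k+1..N}"
    using assms by auto
  thus ?thesis
    unfolding overlap_def by (subst sum.union_disjoint[symmetric]) auto
qed

lemma card_spin_configs: "card (spin_configs k) = 2 ^ k"
  by (simp add: spin_configs_def card_PiE numeral_2_eq_2)

text \<open>Overwriting the first k spins is a bijection between any two fibers of the restriction
  map and does not affect g. So all 2^k fibers contribute equally.\<close>

lemma sum_spin_configs_fiber:
  fixes g :: "(nat \<Rightarrow> real) \<Rightarrow> real"
  assumes k: "k \<le> N" and \<tau>: "\<tau> \<in> spin_configs k"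
    and g: "\<And>\<sigma> \<sigma>'. (\<And>i. i \<in> {k+1..N} \<Longrightarrow> \<sigma> i = \<sigma>' i) \<Longrightarrow> g \<sigma> = g \<sigma>'"
  shows "(\<Sum>\<sigma>\<in>spin_configs N. g \<sigma>)
       = 2 ^ k * (\<Sum>\<sigma> | \<sigma> \<in> spin_configs N \<and> restrict \<sigma> {1..k} = \<tau>. g \<sigma>)"
proof -
  define F where "F = (\<lambda>\<tau>. {\<sigma> \<in> spin_configs N. restrict \<sigma> {1..k} = \<tau>})"
  define glue where "glue = (\<lambda>(\<tau>::nat \<Rightarrow> real) \<sigma> i. if i \<in> {1..k} then \<tau> i else \<sigma> i)"
  have glue_mem: "glue \<rho> \<sigma> \<in> F \<rho>" if "\<rho> \<in> spin_configs k" "\<sigma> \<in> spin_configs N" for \<rho> \<sigma>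
    using that k by (auto simp: F_def glue_def spin_configs_def PiE_iff extensional_def fun_eq_iff)
  have glue_glue: "glue \<rho> (glue \<rho>' \<sigma>) = \<sigma>" if "\<sigma> \<in> F \<rho>" for \<rho> \<rho>' \<sigma>
    using that by (auto simp: F_def glue_def)
  have F_sub: "\<sigma> \<in> spin_configs N" if "\<sigma> \<in> F \<rho>" for \<sigma> \<rho>
    using that by (simp add: F_def)
  have F_eq: "sum g (F \<rho>) = sum g (F \<tau>)" if \<rho>: "\<rho> \<in> spin_configs k" for \<rho>
  proof (rule sum.reindex_bij_witness[of _ "glue \<rho>" "glue \<tau>"])
    show "g (glue \<tau> \<sigma>) = g \<sigma>" for \<sigma>
      by (rule g) (simp add: glue_def)
  qed (use glue_mem glue_glue F_sub \<rho> \<tau> in auto)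
  have "(\<Sum>\<sigma>\<in>spin_configs N. g \<sigma>) = (\<Sum>\<rho>\<in>spin_configs k. sum g (F \<rho>))"
    unfolding F_def
  proof (rule sum.group[symmetric])
    show "(\<lambda>\<sigma>. restrict \<sigma> {1..k}) ` spin_configs N \<subseteq> spin_configs k"
      using k by (auto simp: spin_configs_def PiE_iff)
  qed (rule finite_spin_configs)+
  also have "\<dots> = 2 ^ k * sum g (F \<tau>)"
    by (simp add: F_eq card_spin_configs)
  finally show ?thesis
    by (simp add: F_def)
qed

lemma pmf_spin_marginal_gibbs:
  "pmf (spin_marginal k (gibbs \<beta> N x)) \<tau>
 = (\<Sum>\<sigma> | \<sigma> \<in> spin_configs N \<and> restrict \<sigma> {1..k} = \<tau>. boltzmann_weight \<beta> N x \<sigma>)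
     / partition_function \<beta> N x"
proof -
  define A where "A = (\<lambda>\<sigma>. restrict \<sigma> {1..k}) -` {\<tau>}"
  \<comment> \<open>The preimage \<open>A\<close> may be infinite, since it contains functions
    outside \<open>spin_configs N\<close>; passing through the support leaves a finite sum.\<close>
  have "A \<inter> set_pmf (gibbs \<beta> N x) = (A \<inter> spin_configs N) \<inter> set_pmf (gibbs \<beta> N x)"
    by (auto simp: set_pmf_eq pmf_gibbs)
  hence "measure (gibbs \<beta> N x) A = measure (gibbs \<beta> N x) (A \<inter> spin_configs N)"
    by (metis measure_Int_set_pmf)
  also have "\<dots> = (\<Sum>\<sigma>\<in>A \<inter> spin_configs N. boltzmann_weight \<beta> N x \<sigma> / partition_function \<beta> N x)"
    by (simp add: measure_measure_pmf_finite finite_spin_configs pmf_gibbs)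
  also have "A \<inter> spin_configs N = {\<sigma> \<in> spin_configs N. restrict \<sigma> {1..k} = \<tau>}"
    by (auto simp: A_def)
  finally show ?thesis
    by (simp add: spin_marginal_def pmf_map A_def sum_divide_distrib)
qed

lemma pmf_rademacher_product:
  "pmf (rademacher_product k) \<tau> = (if \<tau> \<in> spin_configs k then 1 / 2 ^ k else 0)"
proof (cases "\<tau> \<in> spin_configs k")
  case True
  hence "\<tau> i = undefined" if "i \<notin> {1..k}" for i
    using that by (auto simp: spin_configs_def PiE_iff extensional_def)
  moreover have "pmf rademacher (\<tau> i) = 1 / 2" if "i \<in> {1..k}" for i
    using spin_value[OF True that] by (auto simp: rademacher_def)
  ultimately show ?thesis
    using True prod.cong[of "{1..k}" "{1..k}" "\<lambda>i. pmf rademacher (\<tau> i)" "\<lambda>_. 1 / 2"]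
    by (simp add: rademacher_product_def pmf_Pi power_one_over)
next
  case False
  show ?thesis
  \<comment> \<open>There are two ways of leaving \<open>spin_configs k\<close>: a value off the
    block that differs from the default \<open>undefined\<close>, or an entry on the block that is
    not a sign. Either one makes the product mass vanish.\<close>
  proof (cases "\<forall>i. i \<notin> {1..k} \<longrightarrow> \<tau> i = undefined")
    case True
    then obtain i where "i \<in> {1..k}" "\<tau> i \<notin> {-1, 1}"
      using False by (auto simp: spin_configs_def PiE_iff extensional_def)
    hence "\<exists>i\<in>{1..k}. pmf rademacher (\<tau> i) = 0"
      by (intro bexI[of _ i]) (auto simp: rademacher_def)
    thus ?thesis
      using False by (simp add: rademacher_product_def pmf_Pi)
  qed (use False in \<open>auto simp: rademacher_product_def pmf_Pi\<close>)
qed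

lemma abs_prob_diff_le_1: "\<bar>measure_pmf.prob p A - measure_pmf.prob q A\<bar> \<le> 1"
  using measure_pmf.prob_le_1[of p A] measure_pmf.prob_le_1[of q A]
    measure_nonneg[of p A] measure_nonneg[of q A]
  by linarith

lemma tv_dist_nonneg: "0 \<le> tv_dist p q"
  unfolding tv_dist_def
  by (rule cSUP_upper2[where x = "{}"]) (auto intro!: bdd_aboveI[of _ 1] abs_prob_diff_le_1)

lemma tv_dist_le_1: "tv_dist p q \<le> 1"
  unfolding tv_dist_def by (intro cSUP_least abs_prob_diff_le_1) auto

text \<open>A one-sided pointwise bound suffices: summing it gives q(A) - p(A) \<le> d q(A) \<le> d
  for all A, and the complement of A gives the reverse difference.\<close>

lemma tv_dist_le_of_lower_bound:
  assumes S: "finite S" "set_pmf q \<subseteq> S"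
    and le: "\<And>y. y \<in> S \<Longrightarrow> (1 - d) * pmf q y \<le> pmf p y"
  shows "tv_dist p q \<le> d"
proof -
  have lower: "(1 - d) * measure_pmf.prob q A \<le> measure_pmf.prob p A" for A
  proof -
    have "A \<inter> set_pmf q = (A \<inter> S) \<inter> set_pmf q"
      using S by auto
    hence "measure_pmf.prob q A = measure_pmf.prob q (A \<inter> S)"
      by (metis measure_Int_set_pmf)
    hence "(1 - d) * measure_pmf.prob q A = (\<Sum>y\<in>A \<inter> S. (1 - d) * pmf q y)"
      using S by (simp add: measure_measure_pmf_finite sum_distrib_left)
    also have "\<dots> \<le> (\<Sum>y\<in>A \<inter> S. pmf p y)"
      by (intro sum_mono le) auto
    also have "\<dots> = measure_pmf.prob p (A \<inter> S)"
      using S by (simp add: measure_measure_pmf_finite)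
    also have "\<dots> \<le> measure_pmf.prob p A"
      by (intro measure_pmf.finite_measure_mono) auto
    finally show ?thesis .
  qed
  from lower[of UNIV] have d: "0 \<le> d"
    by (simp add: measure_pmf.prob_space[simplified])
  have diff: "measure_pmf.prob q A - measure_pmf.prob p A \<le> d" for A
  proof -
    have "d * measure_pmf.prob q A \<le> d"
      using d by (simp add: mult_left_le)
    with lower[of A] show ?thesis
      by (simp add: left_diff_distrib)
  qed
  have "measure_pmf.prob r (- A) = 1 - measure_pmf.prob r A" for r :: "'a pmf" and A
    using measure_pmf.prob_compl[of A r] by (simp add: Compl_eq_Diff_UNIV)
  hence "\<bar>measure_pmf.prob p A - measure_pmf.prob q A\<bar> \<le> d" for A
    using diff[of A] diff[of "- A"] by (simp add: abs_le_iff)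
  thus ?thesis
    unfolding tv_dist_def by (intro cSUP_least) auto
qed

section \<open>Sign patterns, overlaps and local fields\<close>

text \<open>The quartic coefficient of \<open>mult_tanh_le_quartic\<close> for L = 2M, the range of
  the local fields in \<open>abs_local_field_le\<close>.\<close>

definition field_const :: "real \<Rightarrow> real" where
  "field_const M = 1 / (3 * (1 + 2 * M)\<^sup>2)"

text \<open>One realization of the disorder, so that the estimates below are deterministic. The real
  parameter M stands for \<open>CARD('m)\<close> and avoids repeated coercions.\<close>

locale sign_patterns =
  fixes N :: nat and x :: "nat \<Rightarrow> real ^ 'm" and M :: real
  assumes M_eq: "M = CARD('m)"
    and N_pos: "N > 0"
    and pattern_values: "i \<in> {1..N} \<Longrightarrow> x i $ \<nu> \<in> {-1, 1}"
begin

lemma M_ge_1: "1 \<le> M"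
  by (simp add: M_eq Suc_leI)

lemma pattern_inner_self:
  assumes "i \<in> {1..N}"
  shows "x i \<bullet> x i = M"
proof -
  have "x i $ \<nu> * x i $ \<nu> = 1" for \<nu>
    using pattern_values[OF assms, of \<nu>] by auto
  thus ?thesis
    by (simp add: inner_vec_def M_eq)
qed

lemma pattern_norm: "i \<in> {1..N} \<Longrightarrow> norm (x i) = sqrt M"
  by (simp add: norm_eq_sqrt_inner pattern_inner_self)

text \<open>The field \<open>\<langle>m\<^sup>(\<^sup>i\<^sup>), x i\<rangle>\<close>, where \<open>m\<^sup>(\<^sup>i\<^sup>)\<close> is the overlap with the contribution of spin \<open>i\<close>
  removed; at \<open>\<beta> = 1\<close>, spin \<open>i\<close> has mean \<open>tanh\<close> of it conditionally on the other spins.\<close>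

definition local_field :: "(nat \<Rightarrow> real) \<Rightarrow> nat \<Rightarrow> real" where
  "local_field \<sigma> i = overlap N x \<sigma> \<bullet> x i - \<sigma> i * M / N"

lemma norm_overlap_le:
  assumes "\<sigma> \<in> spin_configs N"
  shows "norm (overlap N x \<sigma>) \<le> sqrt M"
proof -
  have "norm (\<Sum>i\<in>{1..N}. \<sigma> i *\<^sub>R x i) \<le> (\<Sum>i\<in>{1..N}. sqrt M)"
  proof (rule sum_norm_le)
    fix i assume i: "i \<in> {1..N}"
    show "norm (\<sigma> i *\<^sub>R x i) \<le> sqrt M"
      using spin_value[OF assms i] by (auto simp: pattern_norm[OF i])
  qed
  thus ?thesis
    using N_pos by (simp add: overlap_def field_simps)
qed

lemma inner_overlap_square_le:
  assumes "i \<in> {1..N}"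
  shows "(v \<bullet> x i)\<^sup>2 \<le> M * (norm v)\<^sup>2"
  using Cauchy_Schwarz_ineq[of v "x i"]
  by (simp only: pattern_inner_self[OF assms] power2_norm_eq_inner mult.commute)

lemma abs_local_field_le:
  assumes "\<sigma> \<in> spin_configs N" "i \<in> {1..N}"
  shows "\<bar>local_field \<sigma> i\<bar> \<le> 2 * M"
proof -
  have "\<bar>overlap N x \<sigma> \<bullet> x i\<bar> \<le> norm (overlap N x \<sigma>) * norm (x i)"
    by (rule Cauchy_Schwarz_ineq2)
  also have "\<dots> \<le> sqrt M * sqrt M"
    using assms M_ge_1 by (intro mult_mono norm_overlap_le) (auto simp: pattern_norm)
  finally have "\<bar>overlap N x \<sigma> \<bullet> x i\<bar> \<le> M"
    using M_ge_1 by simp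
  moreover have "\<bar>\<sigma> i * M / N\<bar> \<le> M"
    using spin_value[OF assms] N_pos M_ge_1 by (auto simp: abs_mult divide_simps)
  ultimately have "\<bar>overlap N x \<sigma> \<bullet> x i\<bar> + \<bar>\<sigma> i * M / N\<bar> \<le> M + M"
    by (rule add_mono)
  with abs_triangle_ineq4 have "\<bar>overlap N x \<sigma> \<bullet> x i - \<sigma> i * M / N\<bar> \<le> M + M"
    by (rule order_trans)
  thus ?thesis
    by (simp add: local_field_def)
qed

section \<open>Single spin flips and conditional means\<close>

lemma overlap_flip:
  assumes "i \<in> {1..N}"
  shows "overlap N x (\<sigma>(i := - \<sigma> i)) = overlap N x \<sigma> - (2 * \<sigma> i / N) *\<^sub>R x i"
proof -
  have "(\<Sum>j\<in>{1..N}. (\<sigma>(i := - \<sigma> i)) j *\<^sub>R x j)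
      = (\<Sum>j\<in>{1..N}. \<sigma> j *\<^sub>R x j - (if j = i then (2 * \<sigma> i) *\<^sub>R x i else 0))"
    by (intro sum.cong) (auto simp: scaleR_2 simp flip: scaleR_scaleR)
  also have "\<dots> = (\<Sum>j\<in>{1..N}. \<sigma> j *\<^sub>R x j) - (2 * \<sigma> i) *\<^sub>R x i"
    using assms by (simp add: sum_subtractf)
  finally show ?thesis
    by (simp add: overlap_def scaleR_diff_right)
qed

text \<open>As |x_i|^2 = M, the flip changes the inner product of overlap and pattern by exactly as
  much as the subtracted self-interaction.\<close>

lemma local_field_flip:
  assumes "i \<in> {1..N}"
  shows "local_field (\<sigma>(i := - \<sigma> i)) i = local_field \<sigma> i"
  using N_pos
  by (simp add: local_field_def overlap_flip[OF assms] inner_diff_left pattern_inner_self[OF assms]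
      field_simps)

text \<open>Given the other spins, spin i has mean tanh of its local field, and the field is a
  function of those spins. Conditioning is expressed by pairing each configuration with its flip at
  i.\<close>

lemma gibbs_avg_spin_field:
  assumes i: "i \<in> {1..N}"
  shows "gibbs_avg N x (\<lambda>\<sigma>. \<sigma> i * local_field \<sigma> i)
       = gibbs_avg N x (\<lambda>\<sigma>. local_field \<sigma> i * tanh (local_field \<sigma> i))"
proof -
  define h where "h = (\<lambda>\<sigma>. local_field \<sigma> i)"
  \<comment> \<open>As a function of spin i, the exponent of the Boltzmann weight is affine with
    slope the local field; \<open>u\<close> is what remains after removing that linear part.\<close>
  define u where "u = (\<lambda>\<sigma>. N / 2 * (norm (overlap N x \<sigma>))\<^sup>2 - \<sigma> i * h \<sigma>)"
  define flip where "flip = (\<lambda>\<sigma>::nat \<Rightarrow> real. \<sigma>(i := - \<sigma> i))"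
  \<comment> \<open>The difference of the two integrands, weighted; it is odd under the flip of spin \<open>i\<close> since
    \<open>u\<close> and \<open>h\<close> do not depend on that spin.\<close>
  define g where "g = (\<lambda>\<sigma>. exp (u \<sigma>) * h \<sigma> * (\<sigma> i / cosh (h \<sigma>)))"
  have flip_mem: "flip \<sigma> \<in> spin_configs N" if "\<sigma> \<in> spin_configs N" for \<sigma>
    using that i by (auto simp: flip_def spin_configs_def PiE_iff extensional_def)
  have h_flip: "h (flip \<sigma>) = h \<sigma>" for \<sigma>
    unfolding h_def flip_def by (rule local_field_flip[OF i])
  have u_flip: "u (flip \<sigma>) = u \<sigma>" if \<sigma>: "\<sigma> \<in> spin_configs N" for \<sigma>
  proof -
    have "(norm (overlap N x (flip \<sigma>)))\<^sup>2
        = (norm (overlap N x \<sigma>))\<^sup>2 - 4 * \<sigma> i / N * (overlap N x \<sigma> \<bullet> x i)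
          + 4 * (\<sigma> i * \<sigma> i) / N\<^sup>2 * M"
      unfolding flip_def overlap_flip[OF i] power2_norm_eq_inner
      by (simp add: inner_diff_left inner_diff_right pattern_inner_self[OF i] inner_commute
          algebra_simps power2_eq_square)
    also have "overlap N x \<sigma> \<bullet> x i = h \<sigma> + \<sigma> i * M / N"
      by (simp add: h_def local_field_def)
    also have "(norm (overlap N x \<sigma>))\<^sup>2 - 4 * \<sigma> i / N * (h \<sigma> + \<sigma> i * M / N)
          + 4 * (\<sigma> i * \<sigma> i) / N\<^sup>2 * M = (norm (overlap N x \<sigma>))\<^sup>2 - 4 * \<sigma> i / N * h \<sigma>"
      by (simp add: algebra_simps power2_eq_square add_divide_distrib)
    finally have *: "(norm (overlap N x (flip \<sigma>)))\<^sup>2 = \<dots>" .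
    have fi: "flip \<sigma> i = - \<sigma> i"
      by (simp add: flip_def)
    show ?thesis
      unfolding u_def * h_flip fi using N_pos by (simp add: field_simps)
  qed
  have "(\<Sum>\<sigma>\<in>spin_configs N. g \<sigma>) = (\<Sum>\<sigma>\<in>spin_configs N. g (flip \<sigma>))"
    by (rule sum.reindex_bij_witness[of _ flip flip]) (auto simp: flip_mem, auto simp: flip_def)
  also have "\<dots> = (\<Sum>\<sigma>\<in>spin_configs N. - g \<sigma>)"
    by (intro sum.cong refl) (simp add: g_def h_flip u_flip, simp add: flip_def)
  finally have "(\<Sum>\<sigma>\<in>spin_configs N. g \<sigma>) = 0"
    by (simp add: sum_negf)
  moreover have "g \<sigma> = boltzmann_weight 1 N x \<sigma> * (\<sigma> i * h \<sigma> - h \<sigma> * tanh (h \<sigma>))"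
    if \<sigma>: "\<sigma> \<in> spin_configs N" for \<sigma>
  proof -
    have "boltzmann_weight 1 N x \<sigma> = exp (u \<sigma>) * exp (\<sigma> i * h \<sigma>)"
      by (simp add: boltzmann_weight_def u_def flip: exp_add)
    moreover have "\<sigma> i / cosh (h \<sigma>) = exp (\<sigma> i * h \<sigma>) * (\<sigma> i - tanh (h \<sigma>))"
      by (rule exp_mult_sign_diff_tanh[OF spin_value[OF \<sigma> i], symmetric])
    ultimately show ?thesis
      unfolding g_def by (simp only:) (simp add: algebra_simps)
  qed
  ultimately have
    "(\<Sum>\<sigma>\<in>spin_configs N. boltzmann_weight 1 N x \<sigma> * (\<sigma> i * h \<sigma> - h \<sigma> * tanh (h \<sigma>))) = 0"
    by simp
  thus ?thesis
    by (simp add: gibbs_avg_def h_def right_diff_distrib sum_subtractf)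
qed

text \<open>Putting the self-interaction back adds (\<sigma> i)^2 M / N, and the spin squares to
  1.\<close>

lemma gibbs_avg_spin_overlap:
  assumes i: "i \<in> {1..N}"
  shows "gibbs_avg N x (\<lambda>\<sigma>. \<sigma> i * (overlap N x \<sigma> \<bullet> x i))
       = M / N + gibbs_avg N x (\<lambda>\<sigma>. local_field \<sigma> i * tanh (local_field \<sigma> i))"
proof -
  have "gibbs_avg N x (\<lambda>\<sigma>. \<sigma> i * (overlap N x \<sigma> \<bullet> x i))
      = gibbs_avg N x (\<lambda>\<sigma>. M / N + \<sigma> i * local_field \<sigma> i)"
  proof (rule gibbs_avg_cong)
    fix \<sigma> assume "\<sigma> \<in> spin_configs N"
    hence "\<sigma> i * \<sigma> i = 1"
      by (rule spin_square[OF _ i])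
    thus "\<sigma> i * (overlap N x \<sigma> \<bullet> x i) = M / N + \<sigma> i * local_field \<sigma> i"
      by (simp add: local_field_def right_diff_distrib)
  qed
  thus ?thesis
    by (simp add: gibbs_avg_add gibbs_avg_const gibbs_avg_spin_field[OF i])
qed

section \<open>Second moment of the overlap\<close>

lemma sum_spin_overlap:
  "(\<Sum>i\<in>{1..N}. \<sigma> i * (overlap N x \<sigma> \<bullet> x i)) = N * (norm (overlap N x \<sigma>))\<^sup>2"
proof -
  \<comment> \<open>Stated for arbitrary v, because unfolding \<open>overlap_def\<close> would
    otherwise expand both factors of the inner product.\<close>
  have "(\<Sum>i\<in>{1..N}. \<sigma> i * (v \<bullet> x i)) = N * (v \<bullet> overlap N x \<sigma>)" for v
    using N_pos by (simp add: overlap_def inner_sum_right)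
  thus ?thesis
    by (simp add: power2_norm_eq_inner)
qed

text \<open>The sum is the quadratic form of the matrix with entries \<open>s \<nu> \<mu>\<close>.
  Its diagonal entries equal N because the patterns are signs, and each off-diagonal entry is
  weighted by a product of two coordinates of v, at most |v|^2.\<close>

lemma pattern_covariance_approx:
  "\<bar>(\<Sum>i\<in>{1..N}. (v \<bullet> x i)\<^sup>2) - N * (norm v)\<^sup>2\<bar> \<le> (norm v)\<^sup>2 * pattern_correlation N x"
proof -
  define s where "s = (\<lambda>\<nu> \<mu>. \<Sum>i\<in>{1..N}. x i $ \<nu> * x i $ \<mu>)"
  have s_diag: "s \<nu> \<nu> = N" for \<nu>
  proof -
    have "x i $ \<nu> * x i $ \<nu> = 1" if "i \<in> {1..N}" for i
      using pattern_values[OF that, of \<nu>] by auto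
    thus ?thesis
      by (simp add: s_def)
  qed
  have "(\<Sum>i\<in>{1..N}. (v \<bullet> x i)\<^sup>2)
      = (\<Sum>i\<in>{1..N}. \<Sum>\<nu>\<in>UNIV. \<Sum>\<mu>\<in>UNIV. v $ \<nu> * v $ \<mu> * (x i $ \<nu> * x i $ \<mu>))"
    by (simp add: inner_vec_def power2_eq_square sum_product mult_ac)
  also have "\<dots> = (\<Sum>\<nu>\<in>UNIV. \<Sum>\<mu>\<in>UNIV. v $ \<nu> * v $ \<mu> * s \<nu> \<mu>)"
    unfolding s_def sum_distrib_left
    by (subst sum.swap, rule sum.cong[OF refl], rule sum.swap)
  also have "\<dots> = (\<Sum>\<nu>\<in>UNIV. v $ \<nu> * v $ \<nu> * N + (\<Sum>\<mu>\<in>UNIV - {\<nu>}. v $ \<nu> * v $ \<mu> * s \<nu> \<mu>))"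
  proof (rule sum.cong[OF refl])
    fix \<nu> :: 'm
    show "(\<Sum>\<mu>\<in>UNIV. v $ \<nu> * v $ \<mu> * s \<nu> \<mu>)
        = v $ \<nu> * v $ \<nu> * N + (\<Sum>\<mu>\<in>UNIV - {\<nu>}. v $ \<nu> * v $ \<mu> * s \<nu> \<mu>)"
      by (subst sum.remove[of UNIV \<nu>]) (auto simp: s_diag)
  qed
  also have "\<dots> = N * (norm v)\<^sup>2 + (\<Sum>\<nu>\<in>UNIV. \<Sum>\<mu>\<in>UNIV - {\<nu>}. v $ \<nu> * v $ \<mu> * s \<nu> \<mu>)"
    by (simp add: sum.distrib power2_norm_eq_inner inner_vec_def sum_distrib_left mult_ac)
  finally have "\<bar>(\<Sum>i\<in>{1..N}. (v \<bullet> x i)\<^sup>2) - N * (norm v)\<^sup>2\<bar>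
      = \<bar>\<Sum>\<nu>\<in>UNIV. \<Sum>\<mu>\<in>UNIV - {\<nu>}. v $ \<nu> * v $ \<mu> * s \<nu> \<mu>\<bar>"
    by simp
  also have "\<dots> \<le> (\<Sum>\<nu>\<in>UNIV. \<Sum>\<mu>\<in>UNIV - {\<nu>}. (norm v)\<^sup>2 * \<bar>s \<nu> \<mu>\<bar>)"
  proof (intro order_trans[OF sum_abs] sum_mono)
    fix \<nu> \<mu> :: 'm
    have "\<bar>v $ \<nu>\<bar> * \<bar>v $ \<mu>\<bar> \<le> norm v * norm v"
      by (intro mult_mono component_le_norm_cart) auto
    thus "\<bar>v $ \<nu> * v $ \<mu> * s \<nu> \<mu>\<bar> \<le> (norm v)\<^sup>2 * \<bar>s \<nu> \<mu>\<bar>"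
      by (simp add: abs_mult power2_eq_square mult_right_mono)
  qed
  finally show ?thesis
    by (simp add: pattern_correlation_def s_def sum_distrib_left)
qed

text \<open>Expanding the squares, the cross terms are summed by \<open>sum_spin_overlap\<close>,
  and the self-interactions contribute N (M / N)^2.\<close>

lemma sum_local_field_square:
  assumes "\<sigma> \<in> spin_configs N"
  shows "(\<Sum>i\<in>{1..N}. (local_field \<sigma> i)\<^sup>2)
       = (\<Sum>i\<in>{1..N}. (overlap N x \<sigma> \<bullet> x i)\<^sup>2) - 2 * M * (norm (overlap N x \<sigma>))\<^sup>2 + M\<^sup>2 / N"
proof -
  have "(\<Sum>i\<in>{1..N}. (local_field \<sigma> i)\<^sup>2)
      = (\<Sum>i\<in>{1..N}. (overlap N x \<sigma> \<bullet> x i)\<^sup>2 - 2 * M / N * (\<sigma> i * (overlap N x \<sigma> \<bullet> x i))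
          + M\<^sup>2 / N\<^sup>2)"
  proof (intro sum.cong refl)
    fix i assume "i \<in> {1..N}"
    hence "(\<sigma> i)\<^sup>2 = 1"
      using spin_square[OF assms] by (simp add: power2_eq_square)
    thus "(local_field \<sigma> i)\<^sup>2 = (overlap N x \<sigma> \<bullet> x i)\<^sup>2
        - 2 * M / N * (\<sigma> i * (overlap N x \<sigma> \<bullet> x i)) + M\<^sup>2 / N\<^sup>2"
      by (simp add: local_field_def power2_diff power_divide power_mult_distrib)
  qed
  also have "\<dots> = (\<Sum>i\<in>{1..N}. (overlap N x \<sigma> \<bullet> x i)\<^sup>2)
      - 2 * M / N * (\<Sum>i\<in>{1..N}. \<sigma> i * (overlap N x \<sigma> \<bullet> x i)) + N * (M\<^sup>2 / N\<^sup>2)"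
    by (simp only: sum.distrib sum_subtractf sum_distrib_left sum_constant) simp
  finally show ?thesis
    unfolding sum_spin_overlap using N_pos by (simp add: power2_eq_square)
qed

lemma field_const_pos: "field_const M > 0"
  using M_ge_1 by (simp add: field_const_def)

text \<open>With Q the sum of the squared fields and c = \<open>field_const M\<close>, the quartic
  bound and Cauchy-Schwarz yield Q - c Q^2 / N. An upper bound on Q is inserted in the first term
  and the lower bound N A / 2 in the second.\<close>

lemma sum_field_tanh_le:
  fixes A :: real
  assumes \<sigma>: "\<sigma> \<in> spin_configs N" and N_large: "8 * M \<le> N"
    and corr: "pattern_correlation N x \<le> N / 4"
  defines "A \<equiv> (norm (overlap N x \<sigma>))\<^sup>2"
  shows "(\<Sum>i\<in>{1..N}. local_field \<sigma> i * tanh (local_field \<sigma> i))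
       \<le> N * A + A * pattern_correlation N x + M\<^sup>2 - field_const M * N / 4 * A\<^sup>2"
proof -
  define Q where "Q = (\<Sum>i\<in>{1..N}. (local_field \<sigma> i)\<^sup>2)"
  define c where "c = field_const M"
  have c: "c > 0" by (simp add: c_def field_const_pos)
  have A: "A \<ge> 0" by (simp add: A_def)
  have Q_eq: "Q = (\<Sum>i\<in>{1..N}. (overlap N x \<sigma> \<bullet> x i)\<^sup>2) - 2 * M * A + M\<^sup>2 / N"
    unfolding Q_def A_def by (rule sum_local_field_square[OF \<sigma>])
  have cov: "\<bar>(\<Sum>i\<in>{1..N}. (overlap N x \<sigma> \<bullet> x i)\<^sup>2) - N * A\<bar> \<le> A * pattern_correlation N x"
    unfolding A_def by (rule pattern_covariance_approx)
  have "M\<^sup>2 / N \<le> M\<^sup>2 / 1"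
    using N_pos by (intro divide_left_mono) auto
  moreover have "0 \<le> M * A"
    using A M_ge_1 by simp
  ultimately have Q_upper: "Q \<le> N * A + A * pattern_correlation N x + M\<^sup>2"
    using Q_eq cov by linarith
  \<comment> \<open>In the lower bound for Q, the assumptions on the correlation and on N each cost
    at most a quarter of N A.\<close>
  have "A * pattern_correlation N x \<le> A * (N / 4)"
    using corr A by (rule mult_left_mono)
  hence corr_A: "A * pattern_correlation N x \<le> N * A / 4"
    by (simp add: mult.commute)
  have "8 * M * A \<le> N * A"
    using N_large A by (rule mult_right_mono)
  hence MA: "2 * M * A \<le> N * A / 4"
    by simp
  have "0 \<le> M\<^sup>2 / N"
    by simp
  hence "(\<Sum>i\<in>{1..N}. (overlap N x \<sigma> \<bullet> x i)\<^sup>2) - 2 * M * A \<le> Q"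
    using Q_eq by simp
  moreover have "N * A - A * pattern_correlation N x \<le> (\<Sum>i\<in>{1..N}. (overlap N x \<sigma> \<bullet> x i)\<^sup>2)"
    using cov by (simp add: abs_le_iff)
  ultimately have "N * A / 2 \<le> Q"
    using corr_A MA by linarith
  hence "(N * A / 2)\<^sup>2 \<le> Q\<^sup>2"
    using A by (intro power_mono) auto
  hence "c / N * (N * A / 2)\<^sup>2 \<le> c / N * Q\<^sup>2"
    using c by (intro mult_left_mono) auto
  hence Q_lower: "c * N / 4 * A\<^sup>2 \<le> c / N * Q\<^sup>2"
    using N_pos by (simp add: power2_eq_square field_simps)
  have "Q\<^sup>2 \<le> N * (\<Sum>i\<in>{1..N}. ((local_field \<sigma> i)\<^sup>2)\<^sup>2)"
    using Cauchy_Schwarz_ineq_sum[of "\<lambda>_. 1" "\<lambda>i. (local_field \<sigma> i)\<^sup>2" "{1..N}"]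
    by (simp add: Q_def)
  hence "c / N * Q\<^sup>2 \<le> c / N * (N * (\<Sum>i\<in>{1..N}. (local_field \<sigma> i) ^ 4))"
    using c by (intro mult_left_mono) (auto simp flip: power_mult)
  hence "c / N * Q\<^sup>2 \<le> c * (\<Sum>i\<in>{1..N}. (local_field \<sigma> i) ^ 4)"
    using N_pos by simp
  moreover have "(\<Sum>i\<in>{1..N}. local_field \<sigma> i * tanh (local_field \<sigma> i))
      \<le> (\<Sum>i\<in>{1..N}. (local_field \<sigma> i)\<^sup>2 - c * (local_field \<sigma> i) ^ 4)"
    using mult_tanh_le_quartic[OF abs_local_field_le[OF \<sigma>]]
    by (intro sum_mono) (simp add: c_def field_const_def)
  ultimately have "(\<Sum>i\<in>{1..N}. local_field \<sigma> i * tanh (local_field \<sigma> i)) \<le> Q - c / N * Q\<^sup>2"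
    unfolding Q_def[symmetric] sum_subtractf sum_distrib_left[symmetric] by linarith
  also have "\<dots> \<le> (N * A + A * pattern_correlation N x + M\<^sup>2) - c * N / 4 * A\<^sup>2"
    by (rule diff_mono[OF Q_upper Q_lower])
  finally show ?thesis
    by (simp only: c_def)
qed

text \<open>Summing \<open>gibbs_avg_spin_overlap\<close> over i expresses N E|m|^2 through the
  fields. After cancellation, E|m|^4 is controlled by E|m|^2, and Jensen's inequality closes this
  into a quadratic inequality for y = sqrt N E|m|^2.\<close>

lemma gibbs_avg_overlap_le:
  assumes N_large: "8 * M \<le> N" and corr: "pattern_correlation N x \<le> N / 4"
  shows "sqrt N * gibbs_avg N x (\<lambda>\<sigma>. (norm (overlap N x \<sigma>))\<^sup>2)
       \<le> 1 + 4 * (M + M\<^sup>2 + pattern_correlation N x / sqrt N) / field_const M"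
proof -
  define A where "A = (\<lambda>\<sigma>. (norm (overlap N x \<sigma>))\<^sup>2)"
  define a where "a = gibbs_avg N x A"
  define R where "R = pattern_correlation N x"
  define c where "c = field_const M"
  define y where "y = sqrt N * a"
  have c: "c > 0" by (simp add: c_def field_const_pos)
  have R: "R \<ge> 0" by (simp add: R_def pattern_correlation_nonneg)
  have sN: "sqrt N > 0" "sqrt N * sqrt N = N"
    using N_pos by auto
  have "N * a = gibbs_avg N x (\<lambda>\<sigma>. \<Sum>i\<in>{1..N}. \<sigma> i * (overlap N x \<sigma> \<bullet> x i))"
    unfolding a_def A_def by (simp only: sum_spin_overlap gibbs_avg_cmult)
  also have "\<dots> = (\<Sum>i\<in>{1..N}. M / N + gibbs_avg N x (\<lambda>\<sigma>. local_field \<sigma> i * tanh (local_field \<sigma> i)))"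
    unfolding gibbs_avg_sum by (intro sum.cong refl gibbs_avg_spin_overlap)
  also have "\<dots> = M + gibbs_avg N x (\<lambda>\<sigma>. \<Sum>i\<in>{1..N}. local_field \<sigma> i * tanh (local_field \<sigma> i))"
    using N_pos by (simp add: sum.distrib gibbs_avg_sum)
  also have "gibbs_avg N x (\<lambda>\<sigma>. \<Sum>i\<in>{1..N}. local_field \<sigma> i * tanh (local_field \<sigma> i))
      \<le> gibbs_avg N x (\<lambda>\<sigma>. (N + R) * A \<sigma> + (M\<^sup>2 + (- (c * N / 4)) * (A \<sigma>)\<^sup>2))"
    using sum_field_tanh_le[OF _ N_large corr]
    by (intro gibbs_avg_mono) (simp add: R_def A_def c_def algebra_simps)
  also have "\<dots> = (N + R) * a + (M\<^sup>2 - c * N / 4 * gibbs_avg N x (\<lambda>\<sigma>. (A \<sigma>)\<^sup>2))"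
    unfolding gibbs_avg_add gibbs_avg_const gibbs_avg_cmult a_def by simp
  \<comment> \<open>The terms \<open>N * a\<close> on the two sides cancel, as is characteristic of
    \<beta> = 1; only the quartic gain is left to control \<open>a\<close>.\<close>
  finally have "c * N / 4 * gibbs_avg N x (\<lambda>\<sigma>. (A \<sigma>)\<^sup>2) \<le> M + M\<^sup>2 + R * a"
    by (simp add: algebra_simps)
  moreover have "c * N / 4 * a\<^sup>2 \<le> c * N / 4 * gibbs_avg N x (\<lambda>\<sigma>. (A \<sigma>)\<^sup>2)"
    unfolding a_def using c by (intro mult_left_mono gibbs_avg_square_le) auto
  ultimately have "c * N / 4 * a\<^sup>2 \<le> M + M\<^sup>2 + R * a"
    by linarith
  moreover have "y\<^sup>2 = N * a\<^sup>2" "R * a = R / sqrt N * y"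
    using sN by (simp_all add: y_def power_mult_distrib)
  ultimately have quad: "c / 4 * y\<^sup>2 \<le> M + M\<^sup>2 + R / sqrt N * y"
    by simp
  \<comment> \<open>For y > 1 the constant M + M^2 is at most (M + M^2) y, so that one factor y can
    be divided out.\<close>
  have "y \<le> 1 + 4 * (M + M\<^sup>2 + R / sqrt N) / c"
  proof (cases "y \<le> 1")
    case True
    moreover have "0 \<le> 4 * (M + M\<^sup>2 + R / sqrt N) / c"
      using c R M_ge_1 by (intro divide_nonneg_nonneg mult_nonneg_nonneg add_nonneg_nonneg) auto
    ultimately show ?thesis
      by linarith
  next
    case False
    have "M + M\<^sup>2 \<le> (M + M\<^sup>2) * y"
      using False M_ge_1 mult_left_mono[of 1 y "M + M\<^sup>2"] by simp
    hence "c / 4 * y * y \<le> (M + M\<^sup>2 + R / sqrt N) * y"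
      using quad by (simp add: power2_eq_square algebra_simps)
    hence "c / 4 * y \<le> M + M\<^sup>2 + R / sqrt N"
      using False by (simp add: mult_le_cancel_right)
    hence "y \<le> 4 * (M + M\<^sup>2 + R / sqrt N) / c"
      using c by (simp add: field_simps)
    thus ?thesis
      by simp
  qed
  thus ?thesis
    by (simp add: y_def a_def A_def R_def c_def)
qed

text \<open>Each spin of the block contributes M / N plus the average of h tanh h, and h^2 is at
  most 2M |m|^2 + 2 (M / N)^2.\<close>

lemma gibbs_avg_block_le:
  assumes "k \<le> N"
  shows "gibbs_avg N x (\<lambda>\<sigma>. overlap N x \<sigma> \<bullet> (\<Sum>i\<in>{1..k}. \<sigma> i *\<^sub>R x i))
       \<le> k / sqrt N * (3 * M\<^sup>2 + 2 * M * (sqrt N * gibbs_avg N x (\<lambda>\<sigma>. (norm (overlap N x \<sigma>))\<^sup>2)))"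
proof -
  define a where "a = gibbs_avg N x (\<lambda>\<sigma>. (norm (overlap N x \<sigma>))\<^sup>2)"
  have term_le: "gibbs_avg N x (\<lambda>\<sigma>. \<sigma> i * (overlap N x \<sigma> \<bullet> x i)) \<le> 3 * M\<^sup>2 / sqrt N + 2 * M * a"
    if i: "i \<in> {1..N}" for i
  proof -
    have "gibbs_avg N x (\<lambda>\<sigma>. local_field \<sigma> i * tanh (local_field \<sigma> i))
        \<le> gibbs_avg N x (\<lambda>\<sigma>. 2 * M * (norm (overlap N x \<sigma>))\<^sup>2 + 2 * (M / N)\<^sup>2)"
    proof (rule gibbs_avg_mono)
      fix \<sigma> assume \<sigma>: "\<sigma> \<in> spin_configs N"
      \<comment> \<open>Here the quartic gain is discarded, so L may be taken to be |h|
        itself.\<close>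
      have "local_field \<sigma> i * tanh (local_field \<sigma> i) \<le> (local_field \<sigma> i)\<^sup>2"
        using mult_tanh_le_quartic[of "local_field \<sigma> i" "\<bar>local_field \<sigma> i\<bar>"] 
        by (smt (verit) divide_nonneg_nonneg zero_le_power2 zero_le_even_power even_numeral)
      also have "\<dots> \<le> 2 * (overlap N x \<sigma> \<bullet> x i)\<^sup>2 + 2 * (\<sigma> i * M / N)\<^sup>2"
        using zero_le_power2[of "overlap N x \<sigma> \<bullet> x i + \<sigma> i * M / N"]
        unfolding local_field_def power2_diff power2_sum by linarith
      also have "(\<sigma> i * M / N)\<^sup>2 = (M / N)\<^sup>2"
        using spin_value[OF \<sigma> i] by auto
      also have "(overlap N x \<sigma> \<bullet> x i)\<^sup>2 \<le> M * (norm (overlap N x \<sigma>))\<^sup>2"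
        by (rule inner_overlap_square_le[OF i])
      finally show "local_field \<sigma> i * tanh (local_field \<sigma> i)
          \<le> 2 * M * (norm (overlap N x \<sigma>))\<^sup>2 + 2 * (M / N)\<^sup>2"
        by simp
    qed
    also have "\<dots> = 2 * M * a + 2 * (M / N)\<^sup>2"
      by (simp only: gibbs_avg_add gibbs_avg_const gibbs_avg_cmult a_def)
    finally have "gibbs_avg N x (\<lambda>\<sigma>. \<sigma> i * (overlap N x \<sigma> \<bullet> x i))
        \<le> M / N + 2 * (M / N)\<^sup>2 + 2 * M * a"
      unfolding gibbs_avg_spin_overlap[OF i] by simp
    \<comment> \<open>Both M / N and (M / N)^2 are weakened to M^2 / sqrt N, so that k / sqrt N
      factors out of the total; counting 1 + 2 such terms gives the constant 3.\<close>
    moreover have sqrt_le: "sqrt N \<le> N" "sqrt N > 0"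
      using N_pos by (auto intro!: real_le_lsqrt simp: power2_eq_square)
    have "N \<le> (real N)\<^sup>2"
      using N_pos by (intro self_le_power) auto
    hence sqrt_le_square: "sqrt N \<le> (real N)\<^sup>2"
      using sqrt_le by linarith
    have "M / N \<le> M\<^sup>2 / sqrt N"
      using M_ge_1 sqrt_le self_le_power[of M 2] by (intro frac_le) auto
    moreover have "(M / N)\<^sup>2 \<le> M\<^sup>2 / sqrt N"
      unfolding power_divide using sqrt_le sqrt_le_square N_pos
      by (intro divide_left_mono) auto
    ultimately show ?thesis
      by linarith
  qed
  have "gibbs_avg N x (\<lambda>\<sigma>. overlap N x \<sigma> \<bullet> (\<Sum>i\<in>{1..k}. \<sigma> i *\<^sub>R x i))
      = (\<Sum>i\<in>{1..k}. gibbs_avg N x (\<lambda>\<sigma>. \<sigma> i * (overlap N x \<sigma> \<bullet> x i)))"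
    by (simp add: inner_sum_right gibbs_avg_sum)
  also have "\<dots> \<le> (\<Sum>i\<in>{1..k}. 3 * M\<^sup>2 / sqrt N + 2 * M * a)"
    using assms by (intro sum_mono term_le) auto
  also have "\<dots> = k / sqrt N * (3 * M\<^sup>2 + 2 * M * (sqrt N * a))"
    using N_pos by (simp add: field_simps)
  finally show ?thesis
    by (simp add: a_def)
qed

section \<open>Lower bound for the marginal weights\<close>

text \<open>Flipping all spins beyond k preserves the fiber and T but turns S into -S. By the
  parallelogram law, the exponents of a flipped pair have a mean no smaller than |S|^2 / (2N), and
  exp is convex.\<close>

lemma fiber_sum_ge:
  assumes k: "k \<le> N"
  shows "(\<Sum>\<sigma> | \<sigma> \<in> spin_configs N \<and> restrict \<sigma> {1..k} = \<tau>.
            exp ((norm (\<Sum>i\<in>{k+1..N}. \<sigma> i *\<^sub>R x i))\<^sup>2 / (2 * N)))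
       \<le> (\<Sum>\<sigma> | \<sigma> \<in> spin_configs N \<and> restrict \<sigma> {1..k} = \<tau>. boltzmann_weight 1 N x \<sigma>)"
proof -
  define F where "F = {\<sigma> \<in> spin_configs N. restrict \<sigma> {1..k} = \<tau>}"
  define S where "S = (\<lambda>\<sigma>. \<Sum>i\<in>{k+1..N}. \<sigma> i *\<^sub>R x i)"
  define T where "T = (\<lambda>\<sigma>. \<Sum>i\<in>{1..k}. \<sigma> i *\<^sub>R x i)"
  define flip where "flip = (\<lambda>(\<sigma>::nat \<Rightarrow> real) i. if i \<in> {k+1..N} then - \<sigma> i else \<sigma> i)"
  have w: "boltzmann_weight 1 N x \<sigma> = exp ((norm (T \<sigma> + S \<sigma>))\<^sup>2 / (2 * N))" for \<sigma>
    unfolding boltzmann_weight_def overlap_eq_split[OF k] T_def S_def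
    using N_pos by (simp add: power_divide power2_eq_square)
  have flip_mem: "flip \<sigma> \<in> F" if "\<sigma> \<in> F" for \<sigma>
  proof -
    have "flip \<sigma> \<in> spin_configs N"
      using that by (auto simp: F_def flip_def spin_configs_def PiE_iff extensional_def)
    moreover have "restrict (flip \<sigma>) {1..k} = restrict \<sigma> {1..k}"
      by (auto simp: flip_def)
    ultimately show ?thesis
      using that by (simp add: F_def)
  qed
  have flip_flip: "flip (flip \<sigma>) = \<sigma>" for \<sigma>
    by (auto simp: flip_def)
  have T_flip: "T (flip \<sigma>) = T \<sigma>" and S_flip: "S (flip \<sigma>) = - S \<sigma>" for \<sigma>
    by (auto simp: T_def S_def flip_def simp flip: sum_negf intro!: sum.cong)
  have "(\<Sum>\<sigma>\<in>F. boltzmann_weight 1 N x \<sigma>) = (\<Sum>\<sigma>\<in>F. boltzmann_weight 1 N x (flip \<sigma>))"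
    by (rule sum.reindex_bij_witness[of _ flip flip]) (auto simp: flip_mem flip_flip)
  hence "2 * (\<Sum>\<sigma>\<in>F. boltzmann_weight 1 N x \<sigma>)
      = (\<Sum>\<sigma>\<in>F. boltzmann_weight 1 N x \<sigma> + boltzmann_weight 1 N x (flip \<sigma>))"
    by (simp add: sum.distrib)
  also have "\<dots> \<ge> (\<Sum>\<sigma>\<in>F. 2 * exp ((norm (S \<sigma>))\<^sup>2 / (2 * N)))"
  proof (rule sum_mono)
    fix \<sigma>
    define c where "c = (norm (S \<sigma>))\<^sup>2 / (2 * N)"
    define p where "p = (norm (T \<sigma> + S \<sigma>))\<^sup>2 / (2 * N)"
    define q where "q = (norm (T \<sigma> - S \<sigma>))\<^sup>2 / (2 * N)"
    have "(norm (T \<sigma> + S \<sigma>))\<^sup>2 + (norm (T \<sigma> - S \<sigma>))\<^sup>2 = 2 * (norm (S \<sigma>))\<^sup>2 + 2 * (norm (T \<sigma>))\<^sup>2"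
      unfolding power2_norm_eq_inner
      by (simp add: inner_add_left inner_add_right inner_diff_left inner_diff_right)
    hence "p + q = 2 * c + 2 * ((norm (T \<sigma>))\<^sup>2 / (2 * N))"
      by (simp add: p_def q_def c_def flip: add_divide_distrib)
         (simp add: add_divide_distrib)
    hence "2 * c \<le> p + q"
      by simp
    \<comment> \<open>Convexity is used through the tangent line of exp at c, applied to both p and
      q.\<close>
    hence "exp c * 2 \<le> exp c * ((1 + (p - c)) + (1 + (q - c)))"
      by (intro mult_left_mono) auto
    also have "\<dots> \<le> exp c * (exp (p - c) + exp (q - c))"
      by (intro mult_left_mono add_mono exp_ge_add_one_self) auto
    also have "\<dots> = exp p + exp q"
      by (simp add: distrib_left flip: exp_add)
    finally show "2 * exp ((norm (S \<sigma>))\<^sup>2 / (2 * N))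
        \<le> boltzmann_weight 1 N x \<sigma> + boltzmann_weight 1 N x (flip \<sigma>)"
      by (simp add: w T_flip S_flip p_def q_def c_def mult.commute)
  qed
  finally show ?thesis
    by (simp add: F_def S_def flip: sum_distrib_left)
qed

text \<open>The weight \<open>v\<close> sees only the spins beyond k, so its sum over one fiber is
  2^-k of its total sum. That total is compared with the partition function through the pointwise
  ratio exp(c - p) and the tangent line of exp at 0.\<close>

lemma pmf_spin_marginal_ge:
  assumes k: "k \<le> N" and \<tau>: "\<tau> \<in> spin_configs k"
  shows "(1 - gibbs_avg N x (\<lambda>\<sigma>. overlap N x \<sigma> \<bullet> (\<Sum>i\<in>{1..k}. \<sigma> i *\<^sub>R x i))) / 2 ^ k
       \<le> pmf (spin_marginal k (gibbs 1 N x)) \<tau>"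
proof -
  define S where "S = (\<lambda>\<sigma>. \<Sum>i\<in>{k+1..N}. \<sigma> i *\<^sub>R x i)"
  define T where "T = (\<lambda>\<sigma>. \<Sum>i\<in>{1..k}. \<sigma> i *\<^sub>R x i)"
  define v where "v = (\<lambda>\<sigma>. exp ((norm (S \<sigma>))\<^sup>2 / (2 * N)))"
  define F where "F = {\<sigma> \<in> spin_configs N. restrict \<sigma> {1..k} = \<tau>}"
  define Z where "Z = partition_function 1 N x"
  have Z: "Z > 0"
    by (simp add: Z_def partition_function_pos)
  have "1 - gibbs_avg N x (\<lambda>\<sigma>. overlap N x \<sigma> \<bullet> T \<sigma>)
      = gibbs_avg N x (\<lambda>\<sigma>. 1 + (-1) * (overlap N x \<sigma> \<bullet> T \<sigma>))"
    unfolding gibbs_avg_add gibbs_avg_const gibbs_avg_cmult by simp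
  also have "\<dots> \<le> (\<Sum>\<sigma>\<in>spin_configs N. v \<sigma>) / Z"
    unfolding gibbs_avg_def Z_def
  proof (intro divide_right_mono sum_mono)
    fix \<sigma>
    define c where "c = (norm (S \<sigma>))\<^sup>2 / (2 * N)"
    define p where "p = (norm (T \<sigma> + S \<sigma>))\<^sup>2 / (2 * N)"
    have ov: "overlap N x \<sigma> = (1 / N) *\<^sub>R (T \<sigma> + S \<sigma>)"
      unfolding T_def S_def by (rule overlap_eq_split[OF k])
    have w: "boltzmann_weight 1 N x \<sigma> = exp p"
      unfolding boltzmann_weight_def ov p_def
      using N_pos by (simp add: power_divide power2_eq_square)
    \<comment> \<open>Written in terms of the full overlap, the difference is minus its inner
      product with T, up to a nonnegative term that is dropped next.\<close>
    have "c - p = (norm (T \<sigma>))\<^sup>2 / (2 * N) - overlap N x \<sigma> \<bullet> T \<sigma>"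
      unfolding p_def c_def ov power2_norm_eq_inner using N_pos
      by (simp add: inner_add_left inner_add_right inner_commute field_simps)
    hence "1 + (-1) * (overlap N x \<sigma> \<bullet> T \<sigma>) \<le> 1 + (c - p)"
      by simp
    also have "\<dots> \<le> exp (c - p)"
      by (rule exp_ge_add_one_self)
    finally have "exp p * (1 + (-1) * (overlap N x \<sigma> \<bullet> T \<sigma>)) \<le> exp p * exp (c - p)"
      by (intro mult_left_mono) auto
    thus "boltzmann_weight 1 N x \<sigma> * (1 + (-1) * (overlap N x \<sigma> \<bullet> T \<sigma>)) \<le> v \<sigma>"
      by (simp add: w v_def c_def flip: exp_add)
  qed (use partition_function_pos[of 1 N x] in simp)
  also have "(\<Sum>\<sigma>\<in>spin_configs N. v \<sigma>) = 2 ^ k * (\<Sum>\<sigma>\<in>F. v \<sigma>)"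
    unfolding F_def
  proof (rule sum_spin_configs_fiber[OF k \<tau>])
    fix \<sigma> \<sigma>' :: "nat \<Rightarrow> real"
    assume "\<And>i. i \<in> {k+1..N} \<Longrightarrow> \<sigma> i = \<sigma>' i"
    hence "S \<sigma> = S \<sigma>'"
      unfolding S_def by (intro sum.cong) auto
    thus "v \<sigma> = v \<sigma>'"
      by (simp add: v_def)
  qed
  also have "2 ^ k * (\<Sum>\<sigma>\<in>F. v \<sigma>) / Z \<le> 2 ^ k * (\<Sum>\<sigma>\<in>F. boltzmann_weight 1 N x \<sigma>) / Z"
    using Z fiber_sum_ge[OF k, of \<tau>] unfolding F_def v_def S_def
    by (intro divide_right_mono mult_left_mono) auto
  also have "\<dots> = 2 ^ k * pmf (spin_marginal k (gibbs 1 N x)) \<tau>"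
    by (simp add: pmf_spin_marginal_gibbs F_def Z_def)
  finally show ?thesis
    by (simp add: T_def field_simps)
qed

lemma tv_dist_marginal_le_block:
  assumes "k \<le> N"
  shows "tv_dist (spin_marginal k (gibbs 1 N x)) (rademacher_product k)
       \<le> gibbs_avg N x (\<lambda>\<sigma>. overlap N x \<sigma> \<bullet> (\<Sum>i\<in>{1..k}. \<sigma> i *\<^sub>R x i))"
proof (rule tv_dist_le_of_lower_bound)
  show "set_pmf (rademacher_product k) \<subseteq> spin_configs k"
    by (auto simp: set_pmf_eq pmf_rademacher_product)
  show "finite (spin_configs k)"
    by (rule finite_spin_configs)
  fix \<tau> assume "\<tau> \<in> spin_configs k"
  thus "(1 - gibbs_avg N x (\<lambda>\<sigma>. overlap N x \<sigma> \<bullet> (\<Sum>i\<in>{1..k}. \<sigma> i *\<^sub>R x i)))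
        * pmf (rademacher_product k) \<tau> \<le> pmf (spin_marginal k (gibbs 1 N x)) \<tau>"
    using pmf_spin_marginal_ge[OF assms] by (simp add: pmf_rademacher_product)
qed

text \<open>For R \<le> N / 4 the moment bound applies; otherwise 4 R / N exceeds 1, which bounds
  any total variation distance. The estimate thus holds for every realization and is affine in R,
  ready for taking expectations.\<close>

lemma tv_dist_marginal_le:
  fixes R :: real
  assumes k: "k \<le> N" and N_large: "8 * M \<le> N"
  defines "R \<equiv> pattern_correlation N x"
  shows "tv_dist (spin_marginal k (gibbs 1 N x)) (rademacher_product k)
       \<le> k / sqrt N * (3 * M\<^sup>2 + 2 * M * (1 + 4 * (M + M\<^sup>2 + R / sqrt N) / field_const M)) + 4 * R / N"
proof -
  define B where "B = 3 * M\<^sup>2 + 2 * M * (1 + 4 * (M + M\<^sup>2 + R / sqrt N) / field_const M)"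
  have R: "0 \<le> R"
    by (simp add: R_def pattern_correlation_nonneg)
  have B: "0 \<le> B"
    unfolding B_def using M_ge_1 R field_const_pos
    by (intro add_nonneg_nonneg mult_nonneg_nonneg divide_nonneg_nonneg) auto
  show ?thesis
  proof (cases "R \<le> N / 4")
    case True
    have "tv_dist (spin_marginal k (gibbs 1 N x)) (rademacher_product k)
        \<le> k / sqrt N * (3 * M\<^sup>2 + 2 * M * (sqrt N * gibbs_avg N x (\<lambda>\<sigma>. (norm (overlap N x \<sigma>))\<^sup>2)))"
      using tv_dist_marginal_le_block[OF k] gibbs_avg_block_le[OF k] by (rule order_trans)
    also have "\<dots> \<le> k / sqrt N * B"
      unfolding B_def R_def using M_ge_1 gibbs_avg_overlap_le[OF N_large] True
      by (intro mult_left_mono add_left_mono) (auto simp: R_def)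
    also have "\<dots> \<le> k / sqrt N * B + 4 * R / N"
      using R by simp
    finally show ?thesis
      by (simp add: B_def)
  next
    case False
    have "tv_dist (spin_marginal k (gibbs 1 N x)) (rademacher_product k) \<le> 1"
      by (rule tv_dist_le_1)
    also have "1 \<le> 4 * R / N"
      using False N_pos by (simp add: field_simps)
    also have "\<dots> \<le> k / sqrt N * B + 4 * R / N"
      using B by simp
    finally show ?thesis
      by (simp add: B_def)
  qed
qed

end

section \<open>Measurability and moments of the disorder\<close>

lemma finite_sign_vectors: "finite {v :: real ^ 'm. \<forall>\<nu>. v $ \<nu> \<in> {-1, 1}}"
proof (rule finite_subset)
  show "{v :: real ^ 'm. \<forall>\<nu>. v $ \<nu> \<in> {-1, 1}} \<subseteq> vec_lambda ` (UNIV \<rightarrow>\<^sub>E {-1, 1})"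
  proof
    fix v :: "real ^ 'm" assume "v \<in> {v. \<forall>\<nu>. v $ \<nu> \<in> {-1, 1}}"
    hence "v = vec_lambda (($) v)" "($) v \<in> UNIV \<rightarrow>\<^sub>E {-1, 1}"
      by auto
    thus "v \<in> vec_lambda ` (UNIV \<rightarrow>\<^sub>E {-1, 1})"
      by blast
  qed
qed (simp add: finite_PiE)

context hopfield_disorder
begin

lemma sign_patterns_realization:
  assumes "N > 0" "\<omega> \<in> space P"
  shows "sign_patterns N (\<lambda>i. \<xi> i \<omega>) (real CARD('m))"
  using assms coords_values by unfold_locales auto

lemma random_pattern: "i \<in> {1..N} \<Longrightarrow> \<xi> i \<in> borel_measurable P"
  using patterns_indep by (auto simp: indep_vars_def)

lemma random_coord: "i \<in> {1..N} \<Longrightarrow> (\<lambda>\<omega>. \<xi> i \<omega> $ \<nu>) \<in> borel_measurable P"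
  using coords_indep by (auto simp: indep_vars_def)

text \<open>The tuple of patterns takes finitely many values, each on a measurable event, so every
  function of the tuple is measurable.\<close>

lemma measurable_function_of_patterns:
  fixes g :: "(nat \<Rightarrow> real ^ 'm) \<Rightarrow> real"
  assumes g: "\<And>x y. (\<And>i. i \<in> {1..N} \<Longrightarrow> x i = y i) \<Longrightarrow> g x = g y"
  shows "(\<lambda>\<omega>. g (\<lambda>i. \<xi> i \<omega>)) \<in> borel_measurable P"
proof -
  define F where "F = {1..N} \<rightarrow>\<^sub>E {v :: real ^ 'm. \<forall>\<nu>. v $ \<nu> \<in> {-1, 1}}"
  \<comment> \<open>Restricting to {1..N} removes the indices about which nothing is known; g does
    not notice the change.\<close>
  define X where "X = (\<lambda>\<omega>. restrict (\<lambda>i. \<xi> i \<omega>) {1..N})"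
  have "finite F"
    unfolding F_def by (intro finite_PiE finite_sign_vectors) auto
  moreover have "X \<in> space P \<rightarrow> F"
    using coords_values by (auto simp: X_def F_def)
  moreover have "X -` {a} \<inter> space P \<in> sets P" if "a \<in> F" for a
  proof -
    have "X -` {a} \<inter> space P = {\<omega> \<in> space P. \<forall>i\<in>{1..N}. \<xi> i \<omega> = a i}"
      using that by (auto simp: X_def F_def PiE_iff extensional_def fun_eq_iff restrict_def)
    also have "\<dots> \<in> sets P"
    proof (rule sets.sets_Collect_finite_All)
      fix i assume i: "i \<in> {1..N}"
      note [measurable] = random_pattern[OF i]
      show "{\<omega> \<in> space P. \<xi> i \<omega> = a i} \<in> sets P"
        by measurable
    qed auto
    finally show ?thesis .
  qed
  ultimately have "X \<in> measurable P (count_space F)"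
    by (simp add: measurable_count_space_eq2)
  hence "(\<lambda>\<omega>. g (X \<omega>)) \<in> borel_measurable P"
    by (rule measurable_compose) simp
  moreover have "g (X \<omega>) = g (\<lambda>i. \<xi> i \<omega>)" for \<omega>
    by (rule g) (simp add: X_def)
  ultimately show ?thesis
    by simp
qed

text \<open>The sum consists of N signs that are centered, by independence of the coordinates, and
  uncorrelated, by independence of the patterns. Its second moment is therefore N.\<close>

lemma expectation_abs_coord_correlation_le:
  assumes "\<nu> \<noteq> \<mu>" and N_pos: "N > 0"
  shows "integrable P (\<lambda>\<omega>. \<bar>\<Sum>i\<in>{1..N}. \<xi> i \<omega> $ \<nu> * \<xi> i \<omega> $ \<mu>\<bar>)" (is ?int)
    and "expectation (\<lambda>\<omega>. \<bar>\<Sum>i\<in>{1..N}. \<xi> i \<omega> $ \<nu> * \<xi> i \<omega> $ \<mu>\<bar>) \<le> sqrt N" (is ?le)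
proof -
  define Y where "Y = (\<lambda>i \<omega>. \<xi> i \<omega> $ \<nu> * \<xi> i \<omega> $ \<mu>)"
  define S where "S = (\<lambda>\<omega>. \<Sum>i\<in>{1..N}. Y i \<omega>)"
  have coord_int: "integrable P (\<lambda>\<omega>. \<xi> i \<omega> $ \<kappa>)" if i: "i \<in> {1..N}" for i \<kappa>
  proof (rule integrable_const_bound[of _ 1])
    show "AE \<omega> in P. norm (\<xi> i \<omega> $ \<kappa>) \<le> 1"
      using coords_values[OF i] by (intro AE_I2) (metis abs_1 abs_minus_cancel empty_iff insert_iff order_refl real_norm_def)
  qed (rule random_coord[OF i])
  have Y_meas: "Y i \<in> borel_measurable P" if "i \<in> {1..N}" for i
    unfolding Y_def using random_coord[OF that] by (intro borel_measurable_times)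
  have Y_sq: "Y i \<omega> * Y i \<omega> = 1" if "i \<in> {1..N}" "\<omega> \<in> space P" for i \<omega>
    using coords_values[OF that, of \<nu>] coords_values[OF that, of \<mu>] by (auto simp: Y_def)
  hence Y_abs: "\<bar>Y i \<omega>\<bar> = 1" if "i \<in> {1..N}" "\<omega> \<in> space P" for i \<omega>
    using that by (metis abs_mult_self_eq abs_1 abs_square_eq_1 power2_eq_square)
  have Y_int: "integrable P (Y i)" if "i \<in> {1..N}" for i
    by (rule integrable_const_bound[of _ 1]) (use Y_abs Y_meas that in auto)
  have YY_int: "integrable P (\<lambda>\<omega>. Y i \<omega> * Y j \<omega>)" if "i \<in> {1..N}" "j \<in> {1..N}" for i j
    by (rule integrable_const_bound[of _ 1])
      (use Y_abs Y_meas that in \<open>auto simp: abs_mult intro!: borel_measurable_times\<close>)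
  have Y_mean: "expectation (Y i) = 0" if i: "i \<in> {1..N}" for i
  proof -
    have "indep_vars (\<lambda>_. borel) (\<lambda>\<kappa> \<omega>. \<xi> i \<omega> $ \<kappa>) {\<nu>, \<mu>}"
      by (rule indep_vars_subset[OF coords_indep[OF i]]) simp
    from indep_vars_lebesgue_integral[OF _ this] show ?thesis
      using assms(1) coord_int[OF i] coords_mean[OF i] by (simp add: Y_def)
  qed
  have indep: "indep_vars (\<lambda>_. borel) Y {1..N}"
    unfolding Y_def
    by (rule indep_vars_compose2[OF patterns_indep, of "\<lambda>_ v. v $ \<nu> * v $ \<mu>"])
       (auto intro!: borel_measurable_continuous_onI continuous_intros)
  have YY_mean: "expectation (\<lambda>\<omega>. Y i \<omega> * Y j \<omega>) = (if i = j then 1 else 0)"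
    if i: "i \<in> {1..N}" and j: "j \<in> {1..N}" for i j
  proof (cases "i = j")
    case True
    have "expectation (\<lambda>\<omega>. Y i \<omega> * Y j \<omega>) = expectation (\<lambda>\<omega>. 1)"
      using True Y_sq[OF j] by (intro Bochner_Integration.integral_cong) auto
    thus ?thesis
      using True by (simp add: prob_space)
  next
    case False
    have "indep_vars (\<lambda>_. borel) Y {i, j}"
      by (rule indep_vars_subset[OF indep]) (use i j in auto)
    moreover have "integrable P (Y l)" if "l \<in> {i, j}" for l
      using that i j Y_int by auto
    ultimately have "expectation (\<lambda>\<omega>. \<Prod>l\<in>{i, j}. Y l \<omega>) = (\<Prod>l\<in>{i, j}. expectation (Y l))"
      by (intro indep_vars_lebesgue_integral) auto
    thus ?thesis
      using False Y_mean[OF i] by simp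
  qed
  have S_sq: "(S \<omega>)\<^sup>2 = (\<Sum>i\<in>{1..N}. \<Sum>j\<in>{1..N}. Y i \<omega> * Y j \<omega>)" for \<omega>
    by (simp add: S_def power2_eq_square sum_product)
  have S_sq_int: "integrable P (\<lambda>\<omega>. (S \<omega>)\<^sup>2)"
    unfolding S_sq by (intro Bochner_Integration.integrable_sum YY_int)
  have "expectation (\<lambda>\<omega>. (S \<omega>)\<^sup>2) = (\<Sum>i\<in>{1..N}. \<Sum>j\<in>{1..N}. if i = j then 1 else 0)"
    unfolding S_sq
    by (subst Bochner_Integration.integral_sum)
       (auto intro!: Bochner_Integration.integrable_sum YY_int sum.cong
          simp: Bochner_Integration.integral_sum YY_int YY_mean)
  hence S_sq_mean: "expectation (\<lambda>\<omega>. (S \<omega>)\<^sup>2) = N"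
    by simp
  have S_int: "integrable P (\<lambda>\<omega>. \<bar>S \<omega>\<bar>)"
    unfolding S_def by (intro integrable_abs Bochner_Integration.integrable_sum Y_int)
  \<comment> \<open>The first moment is bounded by the pointwise inequality 2 sqrt N |S| \<le> S^2 +
    N, whose weight sqrt N is optimal for a second moment of N.\<close>
  have "expectation (\<lambda>\<omega>. \<bar>S \<omega>\<bar>) \<le> expectation (\<lambda>\<omega>. (S \<omega>)\<^sup>2 / (2 * sqrt N) + sqrt N / 2)"
  proof (rule integral_mono)
    fix \<omega>
    have "2 * sqrt N * \<bar>S \<omega>\<bar> \<le> (S \<omega>)\<^sup>2 + N"
      using zero_le_power2[of "\<bar>S \<omega>\<bar> - sqrt N"] by (simp add: power2_diff mult_ac)
    moreover have "(S \<omega>)\<^sup>2 / (2 * sqrt N) + sqrt N / 2 = ((S \<omega>)\<^sup>2 + N) / (2 * sqrt N)"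
      using N_pos by (simp add: add_divide_distrib real_div_sqrt)
    ultimately show "\<bar>S \<omega>\<bar> \<le> (S \<omega>)\<^sup>2 / (2 * sqrt N) + sqrt N / 2"
      using N_pos by (simp add: pos_le_divide_eq mult_ac)
  qed (use S_int S_sq_int in auto)
  also have "\<dots> = sqrt N"
    using S_sq_int N_pos by (simp add: S_sq_mean prob_space field_simps)
  finally show ?le
    by (simp add: S_def Y_def)
  show ?int
    using S_int by (simp add: S_def Y_def)
qed

lemma expectation_pattern_correlation_le:
  assumes "N > 0"
  shows "integrable P (\<lambda>\<omega>. pattern_correlation N (\<lambda>i. \<xi> i \<omega>))"
    and "expectation (\<lambda>\<omega>. pattern_correlation N (\<lambda>i. \<xi> i \<omega>)) \<le> (real CARD('m))\<^sup>2 * sqrt N"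
proof -
  define f where "f = (\<lambda>\<nu> \<mu> \<omega>. \<bar>\<Sum>i\<in>{1..N}. \<xi> i \<omega> $ \<nu> * \<xi> i \<omega> $ \<mu>\<bar>)"
  have f_int: "integrable P (f \<nu> \<mu>)" and f_le: "expectation (f \<nu> \<mu>) \<le> sqrt N" if "\<mu> \<in> UNIV - {\<nu>}" for \<nu> \<mu>
    unfolding f_def using that
    by (auto intro!: expectation_abs_coord_correlation_le[OF _ assms] simp del: One_nat_def)
  have corr: "pattern_correlation N (\<lambda>i. \<xi> i \<omega>) = (\<Sum>\<nu>\<in>UNIV. \<Sum>\<mu>\<in>UNIV - {\<nu>}. f \<nu> \<mu> \<omega>)" for \<omega>
    by (simp add: pattern_correlation_def f_def)
  show "integrable P (\<lambda>\<omega>. pattern_correlation N (\<lambda>i. \<xi> i \<omega>))"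
    unfolding corr by (intro Bochner_Integration.integrable_sum f_int)
  have "expectation (\<lambda>\<omega>. pattern_correlation N (\<lambda>i. \<xi> i \<omega>))
      = (\<Sum>\<nu>\<in>UNIV. \<Sum>\<mu>\<in>UNIV - {\<nu>}. expectation (f \<nu> \<mu>))"
    unfolding corr
    by (subst Bochner_Integration.integral_sum)
       (intro Bochner_Integration.integrable_sum f_int sum.cong refl
         Bochner_Integration.integral_sum; assumption)+
  also have "\<dots> \<le> (\<Sum>\<nu>\<in>(UNIV::'m set). \<Sum>\<mu>\<in>UNIV - {\<nu>}. sqrt N)"
    by (intro sum_mono f_le)
  \<comment> \<open>The diagonal pairs are added only to obtain the simpler factor M^2.\<close>
  also have "\<dots> \<le> (\<Sum>\<nu>\<in>(UNIV::'m set). \<Sum>\<mu>\<in>(UNIV::'m set). sqrt N)"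
    by (intro sum_mono sum_mono2) auto
  also have "\<dots> = (real CARD('m))\<^sup>2 * sqrt N"
    by (simp add: power2_eq_square)
  finally show "expectation (\<lambda>\<omega>. pattern_correlation N (\<lambda>i. \<xi> i \<omega>)) \<le> (real CARD('m))\<^sup>2 * sqrt N" .
qed

lemma measurable_tv_dist_marginal:
  "(\<lambda>\<omega>. tv_dist (spin_marginal k (gibbs \<beta> N (\<lambda>i. \<xi> i \<omega>))) q) \<in> borel_measurable P"
proof (rule measurable_function_of_patterns)
  fix x y :: "nat \<Rightarrow> real ^ 'm"
  assume "\<And>i. i \<in> {1..N} \<Longrightarrow> x i = y i"
  hence "overlap N x = overlap N y"
    unfolding overlap_def by (intro ext arg_cong[where f = "scaleR (1 / real N)"] sum.cong) auto
  hence "gibbs \<beta> N x = gibbs \<beta> N y"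
    by (simp add: gibbs_def partition_function_def boltzmann_weight_def cong: if_cong)
  thus "tv_dist (spin_marginal k (gibbs \<beta> N x)) q = tv_dist (spin_marginal k (gibbs \<beta> N y)) q"
    by simp
qed

section \<open>Passage to convergence in probability\<close>

text \<open>Markov's inequality for the distance, whose expectation is bounded by averaging the
  deterministic estimate over the disorder.\<close>

lemma prob_tv_dist_marginal_gt_le:
  fixes k :: nat and \<epsilon> M :: real
  defines "M \<equiv> real CARD('m)"
  assumes N_pos: "N > 0" and k: "k \<le> N" and N_large: "8 * M \<le> N" and \<epsilon>: "\<epsilon> > 0"
  shows "prob {\<omega> \<in> space P.
            \<bar>tv_dist (spin_marginal k (gibbs 1 N (\<lambda>i. \<xi> i \<omega>))) (rademacher_product k) - 0\<bar> > \<epsilon>}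
       \<le> (k / sqrt N * (3 * M\<^sup>2 + 2 * M * (1 + 4 * (M + 2 * M\<^sup>2) / field_const M))
           + 4 * M\<^sup>2 / sqrt N) / \<epsilon>"
proof -
  define D where "D = (\<lambda>\<omega>. tv_dist (spin_marginal k (gibbs 1 N (\<lambda>i. \<xi> i \<omega>))) (rademacher_product k))"
  define R where "R = (\<lambda>\<omega>. pattern_correlation N (\<lambda>i. \<xi> i \<omega>))"
  define c where "c = field_const M"
  \<comment> \<open>\<open>a\<close> and \<open>b\<close> are the coefficients of the bound in
    \<open>tv_dist_marginal_le\<close>, read as the affine function a + b R of the
    correlation.\<close>
  define b where "b = k / sqrt N * (8 * M / (c * sqrt N)) + 4 / N"
  define a where "a = k / sqrt N * (3 * M\<^sup>2 + 2 * M * (1 + 4 * (M + M\<^sup>2) / c))"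
  have c: "c > 0"
    by (simp add: c_def field_const_def M_def add_pos_nonneg zero_less_power)
  have b: "b \<ge> 0"
    using c by (simp add: b_def M_def)
  have D_meas: "D \<in> borel_measurable P"
    unfolding D_def by (rule measurable_tv_dist_marginal)
  have D_bounds: "0 \<le> D \<omega>" "D \<omega> \<le> 1" for \<omega>
    by (simp_all add: D_def tv_dist_nonneg tv_dist_le_1)
  have D_int: "integrable P D"
    by (rule integrable_const_bound[of _ 1]) (use D_bounds D_meas in auto)
  have R: "integrable P R" "expectation R \<le> M\<^sup>2 * sqrt N"
    unfolding R_def M_def using expectation_pattern_correlation_le[OF N_pos] by auto
  have "expectation D \<le> expectation (\<lambda>\<omega>. a + b * R \<omega>)"
  proof (rule integral_mono)
    fix \<omega> assume "\<omega> \<in> space P"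
    then interpret sign_patterns N "\<lambda>i. \<xi> i \<omega>" M
      unfolding M_def by (rule sign_patterns_realization[OF N_pos])
    have "D \<omega> \<le> k / sqrt N * (3 * M\<^sup>2 + 2 * M * (1 + 4 * (M + M\<^sup>2 + R \<omega> / sqrt N) / c)) + 4 * R \<omega> / N"
      unfolding D_def R_def c_def by (rule tv_dist_marginal_le[OF k N_large])
    also have "\<dots> = a + b * R \<omega>"
      by (simp add: a_def b_def algebra_simps add_divide_distrib)
    finally show "D \<omega> \<le> a + b * R \<omega>" .
  qed (use D_int R in auto)
  also have "\<dots> = a + b * expectation R"
    using R by (simp add: prob_space)
  also have "\<dots> \<le> a + b * (M\<^sup>2 * sqrt N)"
    using b R by (intro add_left_mono mult_left_mono)
  \<comment> \<open>The mean of R / sqrt N is at most M^2, which turns M + M^2 in \<open>a\<close>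
    into M + 2 M^2.\<close>
  also have "\<dots> = k / sqrt N * (3 * M\<^sup>2 + 2 * M * (1 + 4 * (M + 2 * M\<^sup>2) / c)) + 4 * M\<^sup>2 / sqrt N"
  proof -
    have "sqrt N / N = 1 / sqrt N"
      using N_pos by (simp add: divide_simps)
    hence "4 / N * (M\<^sup>2 * sqrt N) = 4 * M\<^sup>2 / sqrt N"
      by (metis (no_types, opaque_lifting) mult.commute mult.left_commute times_divide_eq_right mult.right_neutral)
    moreover have "8 * M / (c * sqrt N) * (M\<^sup>2 * sqrt N) = 8 * M * M\<^sup>2 / c"
      using N_pos by simp
    ultimately have "b * (M\<^sup>2 * sqrt N) = k / sqrt N * (8 * M * M\<^sup>2 / c) + 4 * M\<^sup>2 / sqrt N"
      unfolding b_def by (simp only: distrib_right mult.assoc)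
    thus ?thesis
      by (simp add: a_def algebra_simps add_divide_distrib)
  qed
  finally have mean: "expectation D \<le> \<dots>" .
  have "prob {\<omega> \<in> space P. \<bar>D \<omega> - 0\<bar> > \<epsilon>} \<le> prob {\<omega> \<in> space P. D \<omega> \<ge> \<epsilon>}"
    using D_bounds D_meas by (intro finite_measure_mono) auto
  also have "\<dots> \<le> expectation D / \<epsilon>"
    using D_int D_bounds \<epsilon> by (intro integral_Markov_inequality_measure[of _ _ "{}"]) auto
  also have "\<dots> \<le> (k / sqrt N * (3 * M\<^sup>2 + 2 * M * (1 + 4 * (M + 2 * M\<^sup>2) / c)) + 4 * M\<^sup>2 / sqrt N) / \<epsilon>"
    using mean \<epsilon> by (intro divide_right_mono) auto
  finally show ?thesis
    by (simp add: D_def c_def)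
qed

end

theorem theorem1p4:
  fixes P :: "nat \<Rightarrow> 'p measure"
    and \<xi> :: "nat \<Rightarrow> nat \<Rightarrow> 'p \<Rightarrow> real ^ 'm"
    and k :: "nat \<Rightarrow> nat"
  assumes disorder: "\<And>N. hopfield_disorder (P N) N (\<xi> N)"
    and k_at_top: "filterlim k at_top at_top"
    and k_small: "(\<lambda>N. real (k N) / sqrt (real N)) \<longlonglongrightarrow> 0"
  shows "tendsto_in_probability P
    (\<lambda>N \<omega>. tv_dist (spin_marginal (k N) (gibbs 1 N (\<lambda>i. \<xi> N i \<omega>))) (rademacher_product (k N))) 0"
  unfolding tendsto_in_probability_def
proof (intro conjI allI impI)
  show "(\<lambda>\<omega>. tv_dist (spin_marginal (k N) (gibbs 1 N (\<lambda>i. \<xi> N i \<omega>))) (rademacher_product (k N)))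
      \<in> borel_measurable (P N)" for N
    by (rule hopfield_disorder.measurable_tv_dist_marginal[OF disorder])
next
  fix \<epsilon> :: real assume \<epsilon>: "\<epsilon> > 0"
  define M where "M = real CARD('m)"
  define C where "C = 3 * M\<^sup>2 + 2 * M * (1 + 4 * (M + 2 * M\<^sup>2) / field_const M)"
  define p where "p = (\<lambda>N. measure (P N) {\<omega> \<in> space (P N).
    \<bar>tv_dist (spin_marginal (k N) (gibbs 1 N (\<lambda>i. \<xi> N i \<omega>))) (rademacher_product (k N)) - 0\<bar> > \<epsilon>})"
  have "(\<lambda>N. 4 * M\<^sup>2 / sqrt (real N)) \<longlonglongrightarrow> 0"
    by real_asymp
  hence lim: "(\<lambda>N. (k N / sqrt N * C + 4 * M\<^sup>2 / sqrt N) / \<epsilon>) \<longlonglongrightarrow> 0"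
    using tendsto_divide[OF tendsto_add[OF tendsto_mult[OF k_small tendsto_const]] tendsto_const] \<epsilon>
    by force
  have "\<forall>\<^sub>F N in sequentially. k N / sqrt N < 1"
    using k_small by (rule order_tendstoD) simp
  moreover have "\<forall>\<^sub>F N in sequentially. N > 0"
    by (rule eventually_gt_at_top)
  moreover have "\<forall>\<^sub>F N in sequentially. nat \<lceil>8 * M\<rceil> \<le> N"
    by (rule eventually_ge_at_top)
  ultimately have "\<forall>\<^sub>F N in sequentially. p N \<le> (k N / sqrt N * C + 4 * M\<^sup>2 / sqrt N) / \<epsilon>"
  proof eventually_elim
    case (elim N)
    \<comment> \<open>A ratio k N / sqrt N below 1 places the block of k N spins among the N spins,
      as the probability bound requires.\<close>
    have "sqrt N \<le> N"
      using elim(2) by (auto intro!: real_le_lsqrt simp: power2_eq_square)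
    moreover have "k N < sqrt N"
      using elim(1,2) by (simp add: pos_divide_less_eq)
    ultimately have "k N \<le> N"
      by linarith
    moreover have "8 * M \<le> N"
      using elim(3) by linarith
    ultimately show ?case
      unfolding p_def C_def M_def
      by (intro hopfield_disorder.prob_tv_dist_marginal_gt_le[OF disorder elim(2)] \<epsilon>)
  qed
  hence "p \<longlonglongrightarrow> 0"
    by (intro tendsto_sandwich[OF _ _ tendsto_const lim]) (auto simp: p_def)
  thus "(\<lambda>N. measure (P N) {\<omega> \<in> space (P N). \<epsilon> <
      \<bar>tv_dist (spin_marginal (k N) (gibbs 1 N (\<lambda>i. \<xi> N i \<omega>))) (rademacher_product (k N)) - 0\<bar>})
    \<longlonglongrightarrow> 0"
    by (simp only: p_def)
qed

end
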